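(* (1) The functor of partial topologization $pt:\mathbf{LSS}\to\mathbf{LSS}_{pt}$ defined by $pt(X,\mathcal{L}_X)=(X,\mathcal{L}_X^{swo})$ (and leaving underlying mappings unchanged) is a concrete coreflector. (2) After identification of each locally small space $(X,\mathcal{L}_X)$ with the generalized topological space $(X,\mathcal{L}_X^o,EF(\mathcal{L}_X^o,\mathcal{L}_X))$, this functor is the restriction of the functor $pt:\mathbf{GTS}\to\mathbf{GTS}_{pt}$ given by $pt(X,Cov_X)=(X,\langle Cov_X\cup EssFin(\mathrm{top}(Op_X))\rangle_X)$.
   Context: A locally small space is a pair $(X,\mathcal{L}_X)$ with $X$ a set and $\mathcal{L}_X\subseteq\mathcal{P}(X)$ such that $\emptyset\in\mathcal{L}_X$, $L\cap M,L\cup M\in\mathcal{L}_X$ for all $L,M\in\mathcal{L}_X$, and $\bigcup\mathcal{L}_X=X$. Put $\mathcal{L}_X^o=\{V\subseteq X:V\cap L\in\mathcal{L}_X\ \forall L\in\mathcal{L}_X\}$, $\mathcal{L}_X^s=\{B\subseteq X:B\subseteq L\text{ for some }L\in\mathcal{L}_X\}$, $\mathcal{L}_X^{wo}=\{\bigcup\mathcal{U}:\mathcal{U}\subseteq\mathcal{L}_X\}$ (a topology), $\mathcal{L}_X^{swo}=\mathcal{L}_X^{wo}\cap\mathcal{L}_X^s$. A mapping $f:X\to Y$ between locally small spaces is bounded if each $L\in\mathcal{L}_X$ is contained in $f^{-1}(M)$ for some $M\in\mathcal{L}_Y$, and continuous if $f^{-1}(M)\in\mathcal{L}_X^o$ for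 all $M\in\mathcal{L}_Y$. $\mathbf{LSS}$ is the category of locally small spaces and bounded continuous mappings; $\mathbf{LSS}_{pt}$ is its full subcategory of partially topological spaces, i.e. those with $\mathcal{L}_X=\mathcal{L}_X^{swo}$ (equivalently $\mathcal{L}_X^o=\mathcal{L}_X^{wo}$). A family $\mathcal{U}$ of sets is essentially finite if some finite subfamily has the same union as $\mathcal{U}$; it is essentially finite on $S$ if $\{U\cap S:U\in\mathcal{U}\}$ is essentially finite. $EF(\mathcal{U},\mathcal{V})$ is the family of all subfamilies of $\mathcal{U}$ that are essentially finite on every member of $\mathcal{V}$, and $EssFin(\mathcal{U})=EF(\mathcal{U},\{X\})$. A (Delfs-Knebusch) generalized topological space (gts) is a triple $(X,Op_X,Cov_X)$ with $Op_X\subseteq\mathcal{P}(X)$, $Cov_X\subseteq\mathcal{P}(Op_X)$ such that: (finiteness) if $\mathcal{U}\subseteq Op_X$ is finite, then $\mathcal{U}\in Cov_X$ and $\bigcup\mathcal{U},\bigcap\mathcal{U}\in Op_X$ (with $\bigcap\emptyset=X$); (stability) if $V\in Op_X$ and $\mathcal{U}\in Cov_X$, then $\{V\cap U:U\in\mathcal{U}\}\in Cov_X$; (transitivity) if $\mathcal{U}\in Cov_X$ and, for each $U\in\mathcal{U}$, $\mathcal{V}(U)\in Cov_X$ with $\bigcup\mathcal{V}(U)=U$, then $\bigcup_{U\in\mathcal{U}}\mathcal{V}(U)\in Cov_X$; (saturation) if $\mathcal{U}\in Cov_X$, $\mathcal{V}\subseteq Op_X$, $\bigcup\mathcal{U}=\bigcup\mathcal{V}$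 and each member of $\mathcal{U}$ is contained in a member of $\mathcal{V}$, then $\mathcal{V}\in Cov_X$; (regularity) if $\mathcal{U}\in Cov_X$, $W\subseteq\bigcup\mathcal{U}$ and $W\cap U\in Op_X$ for all $U\in\mathcal{U}$, then $W\in Op_X$. Then $Op_X=\bigcup Cov_X$, so a gts is also written $(X,Cov_X)$, and $Cov_X$ is called a generalized topology on $X$. $\langle\Psi\rangle_X$ denotes the smallest generalized topology on $X$ containing $\Psi\subseteq\mathcal{P}(\mathcal{P}(X))$. $\mathrm{top}(\mathcal{A})$ denotes the smallest topology containing $\mathcal{A}$. $\mathbf{GTS}$ is the category of gtses and strictly continuous mappings (preimages of members of $Cov$ are members of $Cov$); $\mathbf{GTS}_{pt}$ is its full subcategory of partially topological gtses, i.e. those for which $Op_X$ is a topology. Concrete coreflector means: for each object $(X,\mathcal{L}_X)$ of $\mathbf{LSS}$, the identity map $id_X:pt(X,\mathcal{L}_X)\to(X,\mathcal{L}_X)$ is a morphism of $\mathbf{LSS}$ and an $\mathbf{LSS}_{pt}$-coreflection, i.e. every $\mathbf{LSS}$-morphism from an object of $\mathbf{LSS}_{pt}$ to $(X,\mathcal{L}_X)$ factors uniquely through it, and $pt$ is the resulting functor. *)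

theory Defs
  imports "HOL-Analysis.Abstract_Topology"
begin

text \<open>
  Concrete categories over sets, following Adamek, Herrlich and Strecker. Objects have an
  underlying set inside a universe type \<open>'a\<close>; a morphism is its underlying mapping, taken in
  the extensional function space \<open>Und A \<rightarrow>\<^sub>E Und B\<close> so that equality of morphisms is equality
  of mappings on the underlying set. Everything is polymorphic in the universe \<open>'a\<close>; spaces
  carried by several types live together over their sum type.
\<close>

record ('o, 'a) concrete_cat =
  Obj :: "'o set"
  Und :: "'o \<Rightarrow> 'a set"
  Hom :: "'o \<Rightarrow> 'o \<Rightarrow> ('a \<Rightarrow> 'a) set"

definition ident_map :: "'a set \<Rightarrow> 'a \<Rightarrow> 'a" where
  "ident_map X = restrict id X"

definition concrete_category :: "('o, 'a) concrete_cat \<Rightarrow> bool" where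
  "concrete_category C \<longleftrightarrow>
     (\<forall>A\<in>Obj C. \<forall>B\<in>Obj C. Hom C A B \<subseteq> (Und C A \<rightarrow>\<^sub>E Und C B)) \<and>
     (\<forall>A\<in>Obj C. ident_map (Und C A) \<in> Hom C A A) \<and>
     (\<forall>A\<in>Obj C. \<forall>B\<in>Obj C. \<forall>D\<in>Obj C. \<forall>f\<in>Hom C A B. \<forall>g\<in>Hom C B D.
        compose (Und C A) g f \<in> Hom C A D)"

definition full_subcat :: "('o, 'a) concrete_cat \<Rightarrow> 'o set \<Rightarrow> ('o, 'a) concrete_cat" where
  "full_subcat C S = C\<lparr>Obj := Obj C \<inter> S\<rparr>"

text \<open>
  A concrete functor leaves underlying mappings unchanged, so it is determined by its object
  map: its action on morphisms is \<open>f \<mapsto> f\<close>, and preservation of identities and composition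
  is automatic.
\<close>

definition concrete_functor ::
    "('o, 'a) concrete_cat \<Rightarrow> ('p, 'a) concrete_cat \<Rightarrow> ('o \<Rightarrow> 'p) \<Rightarrow> bool" where
  "concrete_functor C D F \<longleftrightarrow>
     concrete_category C \<and> concrete_category D \<and>
     (\<forall>A\<in>Obj C. F A \<in> Obj D \<and> Und D (F A) = Und C A) \<and>
     (\<forall>A\<in>Obj C. \<forall>B\<in>Obj C. Hom C A B \<subseteq> Hom D (F A) (F B))"

definition full_concrete_embedding ::
    "('o, 'a) concrete_cat \<Rightarrow> ('p, 'a) concrete_cat \<Rightarrow> ('o \<Rightarrow> 'p) \<Rightarrow> bool" where
  "full_concrete_embedding C D E \<longleftrightarrow>
     concrete_functor C D E \<and> inj_on E (Obj C) \<and>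
     (\<forall>A\<in>Obj C. \<forall>B\<in>Obj C. Hom C A B = Hom D (E A) (E B))"

text \<open>
  The last conjunct says that \<open>F\<close> acts on morphisms as the functor induced by the
  coreflections: \<open>F f = f\<close> is the morphism whose composite with the coreflection of \<open>B\<close> is
  the composite of \<open>f\<close> with the coreflection of \<open>A\<close>.
\<close>

definition concrete_coreflector ::
    "('o, 'a) concrete_cat \<Rightarrow> ('o, 'a) concrete_cat \<Rightarrow> ('o \<Rightarrow> 'o) \<Rightarrow> bool" where
  "concrete_coreflector C D F \<longleftrightarrow>
     D = full_subcat C (Obj D) \<and> Obj D \<subseteq> Obj C \<and>
     concrete_functor C D F \<and>
     (\<forall>A\<in>Obj C.
        ident_map (Und C A) \<in> Hom C (F A) A \<and>
        (\<forall>B\<in>Obj D. \<forall>f\<in>Hom C B A.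
           \<exists>!g. g \<in> Hom D B (F A) \<and> compose (Und C B) (ident_map (Und C A)) g = f)) \<and>
     (\<forall>A\<in>Obj C. \<forall>B\<in>Obj C. \<forall>f\<in>Hom C A B.
        compose (Und C (F A)) (ident_map (Und C B)) f =
        compose (Und C (F A)) f (ident_map (Und C A)))"


section \<open>Locally small spaces\<close>

type_synonym 'a lss = "'a set \<times> 'a set set"

definition locally_small_space :: "'a set \<Rightarrow> 'a set set \<Rightarrow> bool" where
  "locally_small_space X \<L> \<longleftrightarrow>
     \<L> \<subseteq> Pow X \<and> {} \<in> \<L> \<and> (\<forall>L\<in>\<L>. \<forall>M\<in>\<L>. L \<inter> M \<in> \<L> \<and> L \<union> M \<in> \<L>) \<and> \<Union>\<L> = X"

definition opens :: "'a set \<Rightarrow> 'a set set \<Rightarrow> 'a set set" where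
  "opens X \<L> = {V. V \<subseteq> X \<and> (\<forall>L\<in>\<L>. V \<inter> L \<in> \<L>)}"

definition smalls :: "'a set \<Rightarrow> 'a set set \<Rightarrow> 'a set set" where
  "smalls X \<L> = {B. B \<subseteq> X \<and> (\<exists>L\<in>\<L>. B \<subseteq> L)}"

definition weak_opens :: "'a set set \<Rightarrow> 'a set set" where
  "weak_opens \<L> = {\<Union>\<U> | \<U>. \<U> \<subseteq> \<L>}"

definition small_weak_opens :: "'a set \<Rightarrow> 'a set set \<Rightarrow> 'a set set" where
  "small_weak_opens X \<L> = weak_opens \<L> \<inter> smalls X \<L>"

definition bounded_map ::
    "'a set \<Rightarrow> 'a set set \<Rightarrow> 'b set set \<Rightarrow> ('a \<Rightarrow> 'b) \<Rightarrow> bool" where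
  "bounded_map X \<L> \<M> f \<longleftrightarrow> (\<forall>L\<in>\<L>. \<exists>M\<in>\<M>. L \<subseteq> f -` M \<inter> X)"

definition lss_continuous ::
    "'a set \<Rightarrow> 'a set set \<Rightarrow> 'b set set \<Rightarrow> ('a \<Rightarrow> 'b) \<Rightarrow> bool" where
  "lss_continuous X \<L> \<M> f \<longleftrightarrow> (\<forall>M\<in>\<M>. f -` M \<inter> X \<in> opens X \<L>)"

definition LSS :: "('a lss, 'a) concrete_cat" where
  "LSS = \<lparr> Obj = {(X, \<L>). locally_small_space X \<L>},
           Und = fst,
           Hom = (\<lambda>(X, \<L>) (Y, \<M>).
                    {f \<in> X \<rightarrow>\<^sub>E Y. bounded_map X \<L> \<M> f \<and> lss_continuous X \<L> \<M> f}) \<rparr>"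

definition partially_topological_lss :: "'a lss set" where
  "partially_topological_lss = {(X, \<L>). \<L> = small_weak_opens X \<L>}"

definition LSS_pt :: "('a lss, 'a) concrete_cat" where
  "LSS_pt = full_subcat LSS partially_topological_lss"

definition pt_lss :: "'a lss \<Rightarrow> 'a lss" where
  "pt_lss = (\<lambda>(X, \<L>). (X, small_weak_opens X \<L>))"


section \<open>Generalized topological spaces\<close>

type_synonym 'a gts = "'a set \<times> 'a set set \<times> 'a set set set"

definition essentially_finite :: "'a set set \<Rightarrow> bool" where
  "essentially_finite \<U> \<longleftrightarrow> (\<exists>\<V>\<subseteq>\<U>. finite \<V> \<and> \<Union>\<V> = \<Union>\<U>)"

definition essentially_finite_on :: "'a set set \<Rightarrow> 'a set \<Rightarrow> bool" where
  "essentially_finite_on \<U> S \<longleftrightarrow> essentially_finite {U \<inter> S | U. U \<in> \<U>}"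

definition EF :: "'a set set \<Rightarrow> 'a set set \<Rightarrow> 'a set set set" where
  "EF \<U> \<V> = {\<W>. \<W> \<subseteq> \<U> \<and> (\<forall>V\<in>\<V>. essentially_finite_on \<W> V)}"

definition EssFin :: "'a set \<Rightarrow> 'a set set \<Rightarrow> 'a set set set" where
  "EssFin X \<U> = EF \<U> {X}"

text \<open>In the finiteness axiom, \<open>X \<inter> \<Inter>\<U>\<close> encodes the convention that the empty intersection is \<open>X\<close>.\<close>

definition generalized_topological_space ::
    "'a set \<Rightarrow> 'a set set \<Rightarrow> 'a set set set \<Rightarrow> bool" where
  "generalized_topological_space X Op Cov \<longleftrightarrow>
     Op \<subseteq> Pow X \<and> Cov \<subseteq> Pow Op \<and>
     \<comment> \<open>finiteness\<close>
     (\<forall>\<U>. \<U> \<subseteq> Op \<and> finite \<U> \<longrightarrow> \<U> \<in> Cov \<and> \<Union>\<U> \<in> Op \<and> X \<inter> \<Inter>\<U> \<in> Op) \<and>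
     \<comment> \<open>stability\<close>
     (\<forall>V\<in>Op. \<forall>\<U>\<in>Cov. {V \<inter> U | U. U \<in> \<U>} \<in> Cov) \<and>
     \<comment> \<open>transitivity\<close>
     (\<forall>\<U>\<in>Cov. \<forall>\<V>. (\<forall>U\<in>\<U>. \<V> U \<in> Cov \<and> \<Union>(\<V> U) = U) \<longrightarrow> (\<Union>U\<in>\<U>. \<V> U) \<in> Cov) \<and>
     \<comment> \<open>saturation\<close>
     (\<forall>\<U>\<in>Cov. \<forall>\<V>\<subseteq>Op. \<Union>\<U> = \<Union>\<V> \<and> (\<forall>U\<in>\<U>. \<exists>V\<in>\<V>. U \<subseteq> V) \<longrightarrow> \<V> \<in> Cov) \<and>
     \<comment> \<open>regularity\<close>
     (\<forall>\<U>\<in>Cov. \<forall>W\<subseteq>\<Union>\<U>. (\<forall>U\<in>\<U>. W \<inter> U \<in> Op) \<longrightarrow> W \<in> Op)"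

text \<open>
  Since \<open>{U} \<in> Cov\<close> for every \<open>U \<in> Op\<close> by finiteness, \<open>Op = \<Union>Cov\<close> in every generalized
  topological space, so a generalized topology is given by \<open>Cov\<close> alone.
\<close>

definition generalized_topology :: "'a set \<Rightarrow> 'a set set set \<Rightarrow> bool" where
  "generalized_topology X Cov \<longleftrightarrow> generalized_topological_space X (\<Union>Cov) Cov"

definition generated_gt :: "'a set \<Rightarrow> 'a set set set \<Rightarrow> 'a set set set" where
  "generated_gt X \<Psi> = \<Inter>{Cov. generalized_topology X Cov \<and> \<Psi> \<subseteq> Cov}"

text \<open>
  The smallest topology containing \<open>\<A>\<close>, as a family of sets. Its underlying set is \<open>\<Union>\<A>\<close>, which
  is the whole space when \<open>\<A>\<close> is the family \<open>Op\<close> of a generalized topological space.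
\<close>

definition top_gen :: "'a set set \<Rightarrow> 'a set set" where
  "top_gen \<A> = {U. openin (topology_generated_by \<A>) U}"

definition strictly_continuous ::
    "'a set \<Rightarrow> 'a set set set \<Rightarrow> 'b set set set \<Rightarrow> ('a \<Rightarrow> 'b) \<Rightarrow> bool" where
  "strictly_continuous X CovX CovY f \<longleftrightarrow> (\<forall>\<V>\<in>CovY. {f -` V \<inter> X | V. V \<in> \<V>} \<in> CovX)"

definition GTS :: "('a gts, 'a) concrete_cat" where
  "GTS = \<lparr> Obj = {(X, Op, Cov). generalized_topological_space X Op Cov},
           Und = fst,
           Hom = (\<lambda>(X, OpX, CovX) (Y, OpY, CovY).
                    {f \<in> X \<rightarrow>\<^sub>E Y. strictly_continuous X CovX CovY f}) \<rparr>"

text \<open>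
  The predicate \<open>istopology\<close> does not name the underlying set; it is \<open>X\<close> here because the
  finiteness axiom puts \<open>X\<close> into \<open>Op\<close>.
\<close>

definition partially_topological_gts :: "'a gts set" where
  "partially_topological_gts = {(X, Op, Cov). istopology (\<lambda>U. U \<in> Op)}"

definition GTS_pt :: "('a gts, 'a) concrete_cat" where
  "GTS_pt = full_subcat GTS partially_topological_gts"

definition gts_of_cov :: "'a set \<Rightarrow> 'a set set set \<Rightarrow> 'a gts" where
  "gts_of_cov X Cov = (X, \<Union>Cov, Cov)"

definition pt_gts :: "'a gts \<Rightarrow> 'a gts" where
  "pt_gts = (\<lambda>(X, Op, Cov). gts_of_cov X (generated_gt X (Cov \<union> EssFin X (top_gen Op))))"

text \<open>
  The identification of locally small spaces with generalized topological spaces, leaving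
  mappings unchanged.
\<close>

definition gts_of_lss :: "'a lss \<Rightarrow> 'a gts" where
  "gts_of_lss = (\<lambda>(X, \<L>). (X, opens X \<L>, EF (opens X \<L>) \<L>))"

end

theory Submission
  imports Defs
begin

text \<open>
  Passing from \<open>\<L>\<close> to its small weakly open sets changes neither the weakly open sets nor the sets
  that count as small, and it makes every weakly open set open (\<open>opens_small_weak_opens\<close>). The new
  space is therefore partially topological, and a second passage changes nothing. A preimage of a
  union is a union of preimages, so a bounded continuous map remains bounded and continuous when
  both sides are partially topologized (\<open>Hom_pt_lss\<close>). Applied to a map out of a partially
  topological space, which is its own partial topologization, this is the universal property of the
  coreflection. The coreflection is an identity map, hence factorizations are unique.

  The identification with generalized topological spaces loses nothing, because \<open>\<L>\<close> is itself an
  admissible covering, a member of \<open>EF (opens X \<L>) \<L>\<close>. Hence \<open>\<L>\<close> consists of exactly those open sets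
  on which every admissible covering is essentially finite (\<open>smops_eq_quasicompact_opens\<close>), and a
  strictly continuous map is bounded because the preimage of this covering of its target is an
  admissible covering (\<open>Hom_gts_of_lss\<close>).

  For generalized topological spaces, the open sets of \<open>pt_gts (X, Op, Cov)\<close> are exactly the members of
  \<open>top_gen Op\<close>: the generators make all of them open, and the generalized topology in which every
  family of members of \<open>top_gen Op\<close> is a covering bounds the generated one from above
  (\<open>pt_gts_space\<close>). Functoriality is tested on generators, since the families whose preimages are
  coverings form a generalized topology (\<open>generalized_topological_space_final\<close>).

  Both constructions agree on locally small spaces because the topology generated by the open sets
  consists of the weakly open sets, and because a family of weakly open sets that is essentially
  finite on small sets can be glued, along the covering \<open>\<L>\<close>, from essentially finite families of
  weakly open sets (\<open>generated_gt_EF\<close>).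
\<close>

section \<open>Essentially finite families\<close>

text \<open>
  Choosing the finite subfamily inside \<open>\<W>\<close> itself rather than inside its trace on \<open>S\<close> turns
  essential finiteness into a compactness condition: \<open>S\<close> meets \<open>\<Union>\<W>\<close> inside finitely many members.
\<close>

lemma essentially_finite_on_iff:
  "essentially_finite_on \<W> S \<longleftrightarrow> (\<exists>\<F>\<subseteq>\<W>. finite \<F> \<and> \<Union>\<W> \<inter> S \<subseteq> \<Union>\<F>)"
proof
  assume "essentially_finite_on \<W> S"
  then obtain \<G> where \<G>: "\<G> \<subseteq> (\<lambda>U. U \<inter> S) ` \<W>" "finite \<G>" "\<Union>\<G> = \<Union>((\<lambda>U. U \<inter> S) ` \<W>)"
    unfolding essentially_finite_on_def essentially_finite_def Setcompr_eq_image by blast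
  obtain \<F> where "\<F> \<subseteq> \<W>" "finite \<F>" "\<G> = (\<lambda>U. U \<inter> S) ` \<F>"
    using finite_subset_image[OF \<G>(2,1)] by blast
  with \<G>(3) show "\<exists>\<F>\<subseteq>\<W>. finite \<F> \<and> \<Union>\<W> \<inter> S \<subseteq> \<Union>\<F>"
    by (intro exI[of _ \<F>]) auto
next
  assume "\<exists>\<F>\<subseteq>\<W>. finite \<F> \<and> \<Union>\<W> \<inter> S \<subseteq> \<Union>\<F>"
  then obtain \<F> where \<F>: "\<F> \<subseteq> \<W>" "finite \<F>" "\<Union>\<W> \<inter> S \<subseteq> \<Union>\<F>" by blast
  have "\<Union>((\<lambda>U. U \<inter> S) ` \<F>) = \<Union>((\<lambda>U. U \<inter> S) ` \<W>)" using \<F> by auto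
  with \<F>(1,2) show "essentially_finite_on \<W> S"
    unfolding essentially_finite_on_def essentially_finite_def Setcompr_eq_image
    by (intro exI[of _ "(\<lambda>U. U \<inter> S) ` \<F>"]) auto
qed

lemma essentially_finite_onI:
  "\<F> \<subseteq> \<W> \<Longrightarrow> finite \<F> \<Longrightarrow> \<Union>\<W> \<inter> S \<subseteq> \<Union>\<F> \<Longrightarrow> essentially_finite_on \<W> S"
  unfolding essentially_finite_on_iff by blast

lemma essentially_finite_onE:
  assumes "essentially_finite_on \<W> S"
  obtains \<F> where "\<F> \<subseteq> \<W>" "finite \<F>" "\<Union>\<W> \<inter> S \<subseteq> \<Union>\<F>"
  using assms unfolding essentially_finite_on_iff by blast

lemma essentially_finite_on_mono:
  "essentially_finite_on \<W> S \<Longrightarrow> T \<subseteq> S \<Longrightarrow> essentially_finite_on \<W> T"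
  unfolding essentially_finite_on_iff by blast

lemma finite_essentially_finite_on: "finite \<W> \<Longrightarrow> essentially_finite_on \<W> S"
  by (rule essentially_finite_onI[of \<W>]) auto

lemma essentially_finite_on_vimage:
  assumes "essentially_finite_on \<W> S" "T \<subseteq> X" "f ` T \<subseteq> S"
  shows "essentially_finite_on ((\<lambda>V. f -` V \<inter> X) ` \<W>) T"
proof -
  from assms(1) obtain \<F> where \<F>: "\<F> \<subseteq> \<W>" "finite \<F>" "\<Union>\<W> \<inter> S \<subseteq> \<Union>\<F>"
    by (rule essentially_finite_onE)
  have "\<Union>((\<lambda>V. f -` V \<inter> X) ` \<W>) \<inter> T \<subseteq> \<Union>((\<lambda>V. f -` V \<inter> X) ` \<F>)"
  proof
    fix x assume "x \<in> \<Union>((\<lambda>V. f -` V \<inter> X) ` \<W>) \<inter> T"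
    then have "f x \<in> \<Union>\<W> \<inter> S" "x \<in> X" using assms(3) by auto
    with \<F>(3) show "x \<in> \<Union>((\<lambda>V. f -` V \<inter> X) ` \<F>)" by auto
  qed
  with \<F>(1,2) show ?thesis
    by (intro essentially_finite_onI[of "(\<lambda>V. f -` V \<inter> X) ` \<F>"]) auto
qed

lemma EF_iff: "\<W> \<in> EF \<U> \<V> \<longleftrightarrow> \<W> \<subseteq> \<U> \<and> (\<forall>V\<in>\<V>. essentially_finite_on \<W> V)"
  by (simp add: EF_def)

lemma EF_finite_cover:
  assumes "\<W> \<in> EF \<U> \<V>" "S \<in> \<V>"
  obtains \<F> where "\<F> \<subseteq> \<W>" "finite \<F>" "\<Union>\<W> \<inter> S \<subseteq> \<Union>\<F>"
  using assms unfolding EF_iff essentially_finite_on_iff by blast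

lemma EssFin_iff: "\<W> \<in> EssFin X \<U> \<longleftrightarrow> \<W> \<subseteq> \<U> \<and> essentially_finite_on \<W> X"
  by (simp add: EssFin_def EF_iff)

section \<open>Locally small spaces and their partial topologization\<close>

lemma locally_small_spaceD:
  assumes "locally_small_space X \<L>"
  shows "L \<in> \<L> \<Longrightarrow> L \<subseteq> X" "{} \<in> \<L>"
    "L \<in> \<L> \<Longrightarrow> M \<in> \<L> \<Longrightarrow> L \<inter> M \<in> \<L>" "L \<in> \<L> \<Longrightarrow> M \<in> \<L> \<Longrightarrow> L \<union> M \<in> \<L>"
    "\<Union>\<L> = X"
  using assms unfolding locally_small_space_def by auto

lemma locally_small_space_finite_Union:
  assumes "locally_small_space X \<L>" "finite \<F>" "\<F> \<subseteq> \<L>"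
  shows "\<Union>\<F> \<in> \<L>"
  using assms(2,3)
  by (induction rule: finite_induct)
     (use locally_small_spaceD[OF assms(1)] in auto)

lemma opensD: "V \<in> opens X \<L> \<Longrightarrow> L \<in> \<L> \<Longrightarrow> V \<inter> L \<in> \<L>"
  "V \<in> opens X \<L> \<Longrightarrow> V \<subseteq> X"
  unfolding opens_def by auto

lemma opensI: "V \<subseteq> X \<Longrightarrow> (\<And>L. L \<in> \<L> \<Longrightarrow> V \<inter> L \<in> \<L>) \<Longrightarrow> V \<in> opens X \<L>"
  unfolding opens_def by auto

lemma subset_opens: "locally_small_space X \<L> \<Longrightarrow> \<L> \<subseteq> opens X \<L>"
  using locally_small_spaceD(1,3) by (auto intro!: opensI)

lemma opens_finite_Union:
  assumes "locally_small_space X \<L>" "finite \<F>" "\<F> \<subseteq> opens X \<L>"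
  shows "\<Union>\<F> \<in> opens X \<L>"
proof (rule opensI)
  show "\<Union>\<F> \<subseteq> X" using assms(3) opensD(2) by fastforce
  fix L assume "L \<in> \<L>"
  then have "\<Union>((\<lambda>V. V \<inter> L) ` \<F>) \<in> \<L>"
    using assms by (intro locally_small_space_finite_Union[OF assms(1)]) (use opensD(1) in blast)+
  then show "\<Union>\<F> \<inter> L \<in> \<L>" by (simp only: Int_Union2)
qed

lemma opens_Int:
  assumes "U \<in> opens X \<L>" "V \<in> opens X \<L>"
  shows "U \<inter> V \<in> opens X \<L>"
proof (rule opensI)
  show "U \<inter> V \<subseteq> X" using assms(1) opensD(2) by blast
  show "U \<inter> V \<inter> L \<in> \<L>" if "L \<in> \<L>" for L
    using opensD(1)[OF assms(1) opensD(1)[OF assms(2) that]] by (simp add: Int_assoc)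
qed

lemma opens_finite_Inter:
  assumes "locally_small_space X \<L>" "finite \<F>" "\<F> \<subseteq> opens X \<L>"
  shows "X \<inter> \<Inter>\<F> \<in> opens X \<L>"
  using assms(2,3)
proof (induction rule: finite_induct)
  case empty
  then show ?case
    using locally_small_spaceD(1)[OF assms(1)] by (auto intro!: opensI simp: Int_absorb1)
next
  case (insert V \<F>)
  then have "V \<inter> (X \<inter> \<Inter>\<F>) \<in> opens X \<L>" by (simp add: opens_Int del: Int_iff)
  moreover have "X \<inter> \<Inter>(insert V \<F>) = V \<inter> (X \<inter> \<Inter>\<F>)" by blast
  ultimately show ?case by simp
qed

text \<open>
  A bounded map carries each small set into a single \<open>M \<in> \<M>\<close>, so continuity, which only speaks of
  members of \<open>\<M>\<close>, passes to the larger family of open sets by restricting an open set to \<open>M\<close>.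
\<close>

lemma vimage_opens:
  assumes bd: "bounded_map X \<L> \<M> f" and cont: "lss_continuous X \<L> \<M> f"
    and V: "V \<in> opens Y \<M>"
  shows "f -` V \<inter> X \<in> opens X \<L>"
proof (rule opensI)
  fix L assume L: "L \<in> \<L>"
  with bd obtain M where M: "M \<in> \<M>" "L \<subseteq> f -` M \<inter> X" unfolding bounded_map_def by blast
  have "f -` (V \<inter> M) \<inter> X \<in> opens X \<L>"
    using cont opensD(1)[OF V M(1)] unfolding lss_continuous_def by blast
  then have "f -` (V \<inter> M) \<inter> X \<inter> L \<in> \<L>" using L by (rule opensD)
  moreover have "f -` (V \<inter> M) \<inter> X \<inter> L = f -` V \<inter> X \<inter> L" using M(2) by auto
  ultimately show "f -` V \<inter> X \<inter> L \<in> \<L>" by simp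
qed simp

lemma weak_opensI: "\<U> \<subseteq> \<L> \<Longrightarrow> V = \<Union>\<U> \<Longrightarrow> V \<in> weak_opens \<L>"
  unfolding weak_opens_def by blast

lemma weak_opens_iff: "V \<in> weak_opens \<L> \<longleftrightarrow> (\<forall>x\<in>V. \<exists>L\<in>\<L>. x \<in> L \<and> L \<subseteq> V)"
proof
  assume "\<forall>x\<in>V. \<exists>L\<in>\<L>. x \<in> L \<and> L \<subseteq> V"
  then show "V \<in> weak_opens \<L>" by (intro weak_opensI[of "{L\<in>\<L>. L \<subseteq> V}"]) auto
qed (auto simp: weak_opens_def)

lemma weak_opens_Union: "\<K> \<subseteq> weak_opens \<L> \<Longrightarrow> \<Union>\<K> \<in> weak_opens \<L>"
  unfolding weak_opens_iff
proof
  fix x assume sub: "\<K> \<subseteq> weak_opens \<L>" and "x \<in> \<Union>\<K>"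
  then obtain V where V: "V \<in> \<K>" "x \<in> V" by blast
  with sub have "V \<in> weak_opens \<L>" by blast
  with V obtain L where "L \<in> \<L>" "x \<in> L" "L \<subseteq> V" unfolding weak_opens_iff by blast
  with V(1) show "\<exists>L\<in>\<L>. x \<in> L \<and> L \<subseteq> \<Union>\<K>" by blast
qed

lemma weak_opens_Int:
  assumes "locally_small_space X \<L>" "U \<in> weak_opens \<L>" "V \<in> weak_opens \<L>"
  shows "U \<inter> V \<in> weak_opens \<L>"
  unfolding weak_opens_iff
proof
  fix x assume "x \<in> U \<inter> V"
  then obtain L M where "L \<in> \<L>" "x \<in> L" "L \<subseteq> U" "M \<in> \<L>" "x \<in> M" "M \<subseteq> V"
    using assms(2,3) unfolding weak_opens_iff by blast
  then show "\<exists>L\<in>\<L>. x \<in> L \<and> L \<subseteq> U \<inter> V"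
    using locally_small_spaceD(3)[OF assms(1)] by (intro bexI[of _ "L \<inter> M"]) auto
qed

lemma weak_opens_subset: "locally_small_space X \<L> \<Longrightarrow> V \<in> weak_opens \<L> \<Longrightarrow> V \<subseteq> X"
  using locally_small_spaceD(1) unfolding weak_opens_def by blast

lemma subset_weak_opens: "\<L> \<subseteq> weak_opens \<L>"
  by (auto simp: weak_opens_iff)

lemma opens_subset_weak_opens:
  assumes "locally_small_space X \<L>"
  shows "opens X \<L> \<subseteq> weak_opens \<L>"
proof
  fix V assume V: "V \<in> opens X \<L>"
  show "V \<in> weak_opens \<L>"
    unfolding weak_opens_iff
  proof
    fix x assume "x \<in> V"
    then obtain L where "L \<in> \<L>" "x \<in> L"
      using opensD(2)[OF V] locally_small_spaceD(5)[OF assms] by blast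
    then show "\<exists>L\<in>\<L>. x \<in> L \<and> L \<subseteq> V"
      using opensD(1)[OF V] \<open>x \<in> V\<close> by (intro bexI[of _ "V \<inter> L"]) auto
  qed
qed

lemma small_weak_opens_iff:
  assumes "locally_small_space X \<L>"
  shows "B \<in> small_weak_opens X \<L> \<longleftrightarrow> B \<in> weak_opens \<L> \<and> (\<exists>L\<in>\<L>. B \<subseteq> L)"
  using weak_opens_subset[OF assms] unfolding small_weak_opens_def smalls_def by blast

lemma subset_small_weak_opens:
  "locally_small_space X \<L> \<Longrightarrow> \<L> \<subseteq> small_weak_opens X \<L>"
  using subset_weak_opens by (intro subsetI) (auto simp: small_weak_opens_iff subset_iff)

lemma locally_small_space_small_weak_opens:
  assumes "locally_small_space X \<L>"
  shows "locally_small_space X (small_weak_opens X \<L>)"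
proof -
  note D = locally_small_spaceD[OF assms] and iff = small_weak_opens_iff[OF assms]
  have "L \<inter> M \<in> small_weak_opens X \<L> \<and> L \<union> M \<in> small_weak_opens X \<L>"
    if "L \<in> small_weak_opens X \<L>" "M \<in> small_weak_opens X \<L>" for L M
  proof -
    from that obtain L' M' where w: "L \<in> weak_opens \<L>" "M \<in> weak_opens \<L>"
      and s: "L' \<in> \<L>" "L \<subseteq> L'" "M' \<in> \<L>" "M \<subseteq> M'" by (auto simp: iff)
    have "L \<union> M \<in> weak_opens \<L>" using weak_opens_Union[of "{L, M}"] w by simp
    moreover have "L \<inter> M \<in> weak_opens \<L>" by (rule weak_opens_Int[OF assms w])
    moreover have "L \<union> M \<subseteq> L' \<union> M'" "L' \<union> M' \<in> \<L>" "L \<inter> M \<subseteq> L'" using s D by auto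
    ultimately show ?thesis using s(1) unfolding iff by blast
  qed
  moreover have "\<Union>(small_weak_opens X \<L>) = X"
  proof
    show "\<Union>(small_weak_opens X \<L>) \<subseteq> X" using D(1) by (fastforce simp: iff)
    show "X \<subseteq> \<Union>(small_weak_opens X \<L>)"
      using Union_mono[OF subset_small_weak_opens[OF assms]] D(5) by simp
  qed
  moreover have "{} \<in> small_weak_opens X \<L>" using subset_small_weak_opens[OF assms] D(2) by blast
  ultimately show ?thesis unfolding locally_small_space_def
    by blast
qed

lemma weak_opens_small_weak_opens:
  assumes "locally_small_space X \<L>"
  shows "weak_opens (small_weak_opens X \<L>) = weak_opens \<L>"
proof
  show "weak_opens \<L> \<subseteq> weak_opens (small_weak_opens X \<L>)"
    using subset_small_weak_opens[OF assms] unfolding weak_opens_def by blast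
  show "weak_opens (small_weak_opens X \<L>) \<subseteq> weak_opens \<L>"
  proof
    fix V assume "V \<in> weak_opens (small_weak_opens X \<L>)"
    then obtain \<U> where "\<U> \<subseteq> small_weak_opens X \<L>" "V = \<Union>\<U>" unfolding weak_opens_def by blast
    then show "V \<in> weak_opens \<L>" using weak_opens_Union[of \<U>] by (auto simp: small_weak_opens_def)
  qed
qed

lemma small_weak_opens_idem:
  assumes "locally_small_space X \<L>"
  shows "small_weak_opens X (small_weak_opens X \<L>) = small_weak_opens X \<L>"
proof -
  have "smalls X (small_weak_opens X \<L>) = smalls X \<L>"
    using subset_small_weak_opens[OF assms]
    unfolding smalls_def set_eq_iff mem_Collect_eq
    by (meson small_weak_opens_iff[OF assms] order_trans subsetD)
  then show ?thesis
    using weak_opens_small_weak_opens[OF assms] unfolding small_weak_opens_def by simp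
qed

text \<open>
  Every open set of a locally small space is weakly open because \<open>\<L>\<close> covers \<open>X\<close>. Conversely, a
  weakly open set meets a small weakly open set in a small weakly open set. So the open sets of the
  partial topologization form a topology, whereas those of \<open>(X, \<L>)\<close> need not.
\<close>

lemma opens_small_weak_opens:
  assumes "locally_small_space X \<L>"
  shows "opens X (small_weak_opens X \<L>) = weak_opens \<L>"
proof
  show "opens X (small_weak_opens X \<L>) \<subseteq> weak_opens \<L>"
    using opens_subset_weak_opens[OF locally_small_space_small_weak_opens[OF assms]]
    by (simp add: weak_opens_small_weak_opens[OF assms])
  show "weak_opens \<L> \<subseteq> opens X (small_weak_opens X \<L>)"
  proof
    fix V assume V: "V \<in> weak_opens \<L>"
    show "V \<in> opens X (small_weak_opens X \<L>)"
    proof (rule opensI)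
      show "V \<subseteq> X" using weak_opens_subset[OF assms V] .
      show "V \<inter> B \<in> small_weak_opens X \<L>" if "B \<in> small_weak_opens X \<L>" for B
        using that weak_opens_Int[OF assms V] by (auto simp: small_weak_opens_iff[OF assms])
    qed
  qed
qed

section \<open>Partial topologization as a coreflector\<close>

lemma Obj_LSS: "(X, \<L>) \<in> Obj LSS \<longleftrightarrow> locally_small_space X \<L>"
  by (simp add: LSS_def)

lemma Und_LSS: "Und LSS A = fst A"
  by (simp add: LSS_def)

lemma Hom_LSS: "f \<in> Hom LSS (X, \<L>) (Y, \<M>) \<longleftrightarrow>
    f \<in> X \<rightarrow>\<^sub>E Y \<and> bounded_map X \<L> \<M> f \<and> lss_continuous X \<L> \<M> f"
  by (simp add: LSS_def)

lemma ident_map_PiE: "ident_map X \<in> X \<rightarrow>\<^sub>E X"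
  by (simp add: ident_map_def)

lemma vimage_ident_map: "V \<subseteq> X \<Longrightarrow> ident_map X -` V \<inter> X = V"
  by (auto simp: ident_map_def)

lemma vimage_compose:
  "f \<in> X \<rightarrow> Y \<Longrightarrow> compose X g f -` V \<inter> X = f -` (g -` V \<inter> Y) \<inter> X"
  by (auto simp: compose_def)

lemma compose_PiE: "f \<in> X \<rightarrow>\<^sub>E Y \<Longrightarrow> g \<in> Y \<rightarrow>\<^sub>E Z \<Longrightarrow> compose X g f \<in> X \<rightarrow>\<^sub>E Z"
  by (auto simp: compose_def)

lemma compose_ident_map_left: "f \<in> X \<rightarrow>\<^sub>E Y \<Longrightarrow> compose X (ident_map Y) f = f"
  by (auto simp: compose_def ident_map_def fun_eq_iff restrict_def PiE_iff extensional_def)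

lemma compose_ident_map_right: "f \<in> X \<rightarrow>\<^sub>E Y \<Longrightarrow> compose X f (ident_map X) = f"
  by (auto simp: compose_def ident_map_def fun_eq_iff restrict_def PiE_iff extensional_def)

lemma concrete_category_LSS: "concrete_category LSS"
  unfolding concrete_category_def
proof (intro conjI ballI)
  fix A B :: "'a lss" show "Hom LSS A B \<subseteq> (Und LSS A \<rightarrow>\<^sub>E Und LSS B)"
    by (cases A; cases B) (auto simp: Hom_LSS Und_LSS)
next
  fix A :: "'a lss" assume A: "A \<in> Obj LSS"
  obtain X \<L> where [simp]: "A = (X, \<L>)" by (cases A)
  have lss: "locally_small_space X \<L>" using A by (simp add: Obj_LSS)
  have vim: "ident_map X -` L \<inter> X = L" if "L \<in> \<L>" for L
    using vimage_ident_map locally_small_spaceD(1)[OF lss that] .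
  have "bounded_map X \<L> \<L> (ident_map X)"
    unfolding bounded_map_def using vim by blast
  moreover have "lss_continuous X \<L> \<L> (ident_map X)"
    unfolding lss_continuous_def using vim subset_opens[OF lss] by auto
  ultimately show "ident_map (Und LSS A) \<in> Hom LSS A A"
    by (simp add: Hom_LSS Und_LSS ident_map_PiE)
next
  fix A B D :: "'a lss" and f g assume "A \<in> Obj LSS" "B \<in> Obj LSS" "D \<in> Obj LSS"
    and f: "f \<in> Hom LSS A B" and g: "g \<in> Hom LSS B D"
  obtain X \<L> Y \<M> Z \<N> where [simp]: "A = (X, \<L>)" "B = (Y, \<M>)" "D = (Z, \<N>)"
    by (cases A; cases B; cases D)
  have f': "f \<in> X \<rightarrow>\<^sub>E Y" "bounded_map X \<L> \<M> f" "lss_continuous X \<L> \<M> f"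
    and g': "g \<in> Y \<rightarrow>\<^sub>E Z" "bounded_map Y \<M> \<N> g" "lss_continuous Y \<M> \<N> g"
    using f g by (simp_all add: Hom_LSS)
  have vim: "compose X g f -` V \<inter> X = f -` (g -` V \<inter> Y) \<inter> X" for V
    using f'(1) by (intro vimage_compose) auto
  have "bounded_map X \<L> \<N> (compose X g f)"
    unfolding bounded_map_def vim
  proof
    fix L assume "L \<in> \<L>"
    with f'(2) obtain M where "M \<in> \<M>" "L \<subseteq> f -` M \<inter> X" unfolding bounded_map_def by blast
    moreover from this g'(2) obtain N where "N \<in> \<N>" "M \<subseteq> g -` N \<inter> Y"
      unfolding bounded_map_def by blast
    ultimately show "\<exists>N\<in>\<N>. L \<subseteq> f -` (g -` N \<inter> Y) \<inter> X" by blast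
  qed
  moreover have "lss_continuous X \<L> \<N> (compose X g f)"
    using vimage_opens[OF f'(2,3)] g'(3) unfolding lss_continuous_def vim by blast
  ultimately show "compose (Und LSS A) g f \<in> Hom LSS A D"
    using f'(1) g'(1) by (simp add: Hom_LSS Und_LSS compose_PiE)
qed

lemma concrete_category_full_subcat:
  "concrete_category C \<Longrightarrow> concrete_category (full_subcat C S)"
  by (auto simp: concrete_category_def full_subcat_def)

lemma Obj_LSS_pt: "A \<in> Obj LSS_pt \<longleftrightarrow> A \<in> Obj LSS \<and> pt_lss A = A"
  by (cases A) (auto simp: LSS_pt_def full_subcat_def partially_topological_lss_def pt_lss_def)

lemma LSS_pt_simps [simp]: "Und LSS_pt = Und LSS" "Hom LSS_pt = Hom LSS"
  by (simp_all add: LSS_pt_def full_subcat_def)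

lemma pt_lss_in_LSS_pt: "A \<in> Obj LSS \<Longrightarrow> pt_lss A \<in> Obj LSS_pt"
  by (cases A) (simp add: Obj_LSS_pt Obj_LSS pt_lss_def locally_small_space_small_weak_opens
      small_weak_opens_idem)

lemma fst_pt_lss: "fst (pt_lss A) = fst A"
  by (simp add: pt_lss_def split: prod.split)

lemma Hom_pt_lss:
  assumes "A \<in> Obj LSS" "B \<in> Obj LSS" "f \<in> Hom LSS A B"
  shows "f \<in> Hom LSS (pt_lss A) (pt_lss B)"
proof -
  obtain X \<L> Y \<M> where [simp]: "A = (X, \<L>)" "B = (Y, \<M>)" by (cases A; cases B)
  have lss: "locally_small_space X \<L>" "locally_small_space Y \<M>"
    using assms(1,2) by (simp_all add: Obj_LSS)
  have f: "f \<in> X \<rightarrow>\<^sub>E Y" "bounded_map X \<L> \<M> f" "lss_continuous X \<L> \<M> f"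
    using assms(3) by (simp_all add: Hom_LSS)
  have "bounded_map X (small_weak_opens X \<L>) (small_weak_opens Y \<M>) f"
    unfolding bounded_map_def
  proof
    fix B assume "B \<in> small_weak_opens X \<L>"
    then obtain L where "L \<in> \<L>" "B \<subseteq> L" by (auto simp: small_weak_opens_iff[OF lss(1)])
    moreover from this f(2) obtain M where "M \<in> \<M>" "L \<subseteq> f -` M \<inter> X"
      unfolding bounded_map_def by blast
    ultimately show "\<exists>M\<in>small_weak_opens Y \<M>. B \<subseteq> f -` M \<inter> X"
      using subset_small_weak_opens[OF lss(2)] by blast
  qed
  moreover have "lss_continuous X (small_weak_opens X \<L>) (small_weak_opens Y \<M>) f"
    unfolding lss_continuous_def opens_small_weak_opens[OF lss(1)]
  proof
    fix M assume "M \<in> small_weak_opens Y \<M>"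
    then obtain \<U> where \<U>: "\<U> \<subseteq> \<M>" "M = \<Union>\<U>"
      unfolding small_weak_opens_def weak_opens_def by blast
    have "(\<lambda>U. f -` U \<inter> X) ` \<U> \<subseteq> weak_opens \<L>"
      using f(3) \<U>(1) opens_subset_weak_opens[OF lss(1)] unfolding lss_continuous_def by blast
    then have "(\<Union>U\<in>\<U>. f -` U \<inter> X) \<in> weak_opens \<L>" by (rule weak_opens_Union)
    then show "f -` M \<inter> X \<in> weak_opens \<L>" by (simp add: \<U>(2) vimage_Union)
  qed
  ultimately show ?thesis using f(1) by (simp add: Hom_LSS pt_lss_def)
qed

lemma ident_map_pt_lss:
  assumes "A \<in> Obj LSS"
  shows "ident_map (fst A) \<in> Hom LSS (pt_lss A) A"
proof -
  obtain X \<L> where [simp]: "A = (X, \<L>)" by (cases A)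
  have lss: "locally_small_space X \<L>" using assms by (simp add: Obj_LSS)
  have vim: "ident_map X -` L \<inter> X = L" if "L \<in> \<L>" for L
    using vimage_ident_map locally_small_spaceD(1)[OF lss that] .
  have "bounded_map X (small_weak_opens X \<L>) \<L> (ident_map X)"
    unfolding bounded_map_def
  proof
    fix B assume "B \<in> small_weak_opens X \<L>"
    then obtain L where "L \<in> \<L>" "B \<subseteq> L" by (auto simp: small_weak_opens_iff[OF lss])
    then show "\<exists>M\<in>\<L>. B \<subseteq> ident_map X -` M \<inter> X" using vim by blast
  qed
  moreover have "lss_continuous X (small_weak_opens X \<L>) \<L> (ident_map X)"
    unfolding lss_continuous_def opens_small_weak_opens[OF lss]
    using vim subset_weak_opens[of \<L>] by auto
  ultimately show ?thesis by (simp add: Hom_LSS pt_lss_def ident_map_PiE)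
qed

lemma concrete_category_LSS_pt: "concrete_category LSS_pt"
  unfolding LSS_pt_def by (rule concrete_category_full_subcat[OF concrete_category_LSS])

lemma concrete_functor_pt_lss: "concrete_functor LSS LSS_pt pt_lss"
  unfolding concrete_functor_def
  by (simp add: concrete_category_LSS concrete_category_LSS_pt pt_lss_in_LSS_pt Und_LSS fst_pt_lss
      Hom_pt_lss subset_iff)

text \<open>
  A partially topological \<open>B\<close> is fixed by \<open>pt_lss\<close>, so functoriality alone lifts a morphism
  \<open>B \<rightarrow> A\<close> to \<open>B = pt_lss B \<rightarrow> pt_lss A\<close>. The coreflection is an identity map, which makes the lift
  unique.
\<close>

lemma concrete_coreflector_pt_lss: "concrete_coreflector LSS LSS_pt pt_lss"
  unfolding concrete_coreflector_def
proof (intro conjI ballI)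
  show "LSS_pt = full_subcat LSS (Obj LSS_pt)" by (simp add: LSS_pt_def full_subcat_def Int_assoc)
  show "Obj LSS_pt \<subseteq> Obj LSS" by (auto simp: Obj_LSS_pt)
  show "concrete_functor LSS LSS_pt pt_lss" by (rule concrete_functor_pt_lss)
next
  fix A :: "'a lss" assume "A \<in> Obj LSS"
  then show "ident_map (Und LSS A) \<in> Hom LSS (pt_lss A) A"
    by (simp add: Und_LSS ident_map_pt_lss)
next
  fix A B :: "'a lss" and f
  assume A: "A \<in> Obj LSS" and B: "B \<in> Obj LSS_pt" and f: "f \<in> Hom LSS B A"
  have comp: "compose (Und LSS B) (ident_map (Und LSS A)) g = g"
    if "g \<in> Hom LSS B (pt_lss A)" for g
  proof -
    have "g \<in> fst B \<rightarrow>\<^sub>E fst A"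
      using that by (cases A; cases B) (simp add: pt_lss_def Hom_LSS)
    then show ?thesis by (simp add: Und_LSS compose_ident_map_left)
  qed
  have "f \<in> Hom LSS B (pt_lss A)"
    using Hom_pt_lss[OF _ A f] B by (simp add: Obj_LSS_pt)
  then show "\<exists>!g. g \<in> Hom LSS_pt B (pt_lss A) \<and>
      compose (Und LSS B) (ident_map (Und LSS A)) g = f"
    using comp by auto
next
  fix A B :: "'a lss" and f assume "f \<in> Hom LSS A B"
  then have "f \<in> fst A \<rightarrow>\<^sub>E fst B" by (cases A; cases B) (simp add: Hom_LSS)
  then show "compose (Und LSS (pt_lss A)) (ident_map (Und LSS B)) f =
      compose (Und LSS (pt_lss A)) f (ident_map (Und LSS A))"
    by (simp add: Und_LSS fst_pt_lss compose_ident_map_left compose_ident_map_right)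
qed

section \<open>Generalized topological spaces\<close>

lemma generalized_topological_spaceD:
  assumes "generalized_topological_space X Op Cov"
  shows "Op \<subseteq> Pow X" "Cov \<subseteq> Pow Op"
    "\<U> \<subseteq> Op \<Longrightarrow> finite \<U> \<Longrightarrow> \<U> \<in> Cov"
    "\<U> \<subseteq> Op \<Longrightarrow> finite \<U> \<Longrightarrow> \<Union>\<U> \<in> Op"
    "\<U> \<subseteq> Op \<Longrightarrow> finite \<U> \<Longrightarrow> X \<inter> \<Inter>\<U> \<in> Op"
    "V \<in> Op \<Longrightarrow> \<U> \<in> Cov \<Longrightarrow> (\<lambda>U. V \<inter> U) ` \<U> \<in> Cov"
    "\<U> \<in> Cov \<Longrightarrow> (\<And>U. U \<in> \<U> \<Longrightarrow> \<V> U \<in> Cov \<and> \<Union>(\<V> U) = U) \<Longrightarrow> (\<Union>U\<in>\<U>. \<V> U) \<in> Cov"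
    "\<U> \<in> Cov \<Longrightarrow> \<W> \<subseteq> Op \<Longrightarrow> \<Union>\<U> = \<Union>\<W> \<Longrightarrow> (\<And>U. U \<in> \<U> \<Longrightarrow> \<exists>W\<in>\<W>. U \<subseteq> W) \<Longrightarrow> \<W> \<in> Cov"
    "\<U> \<in> Cov \<Longrightarrow> W \<subseteq> \<Union>\<U> \<Longrightarrow> (\<And>U. U \<in> \<U> \<Longrightarrow> W \<inter> U \<in> Op) \<Longrightarrow> W \<in> Op"
proof -
  note axioms = assms[unfolded generalized_topological_space_def Setcompr_eq_image]
  show "Op \<subseteq> Pow X" "Cov \<subseteq> Pow Op" using axioms by simp_all
  show "\<U> \<subseteq> Op \<Longrightarrow> finite \<U> \<Longrightarrow> \<U> \<in> Cov" "\<U> \<subseteq> Op \<Longrightarrow> finite \<U> \<Longrightarrow> \<Union>\<U> \<in> Op"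
    "\<U> \<subseteq> Op \<Longrightarrow> finite \<U> \<Longrightarrow> X \<inter> \<Inter>\<U> \<in> Op"
    "V \<in> Op \<Longrightarrow> \<U> \<in> Cov \<Longrightarrow> (\<lambda>U. V \<inter> U) ` \<U> \<in> Cov" using axioms by simp_all
  show "(\<Union>U\<in>\<U>. \<V> U) \<in> Cov"
    if "\<U> \<in> Cov" "\<And>U. U \<in> \<U> \<Longrightarrow> \<V> U \<in> Cov \<and> \<Union>(\<V> U) = U"
    using conjunct1[OF conjunct2[OF conjunct2[OF conjunct2[OF conjunct2[OF axioms]]]]] that by simp
  show "\<W> \<in> Cov"
    if "\<U> \<in> Cov" "\<W> \<subseteq> Op" "\<Union>\<U> = \<Union>\<W>" "\<And>U. U \<in> \<U> \<Longrightarrow> \<exists>W\<in>\<W>. U \<subseteq> W"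
    using conjunct1[OF conjunct2[OF conjunct2[OF conjunct2[OF conjunct2[OF conjunct2[OF axioms]]]]]]
      that by simp
  show "W \<in> Op" if "\<U> \<in> Cov" "W \<subseteq> \<Union>\<U>" "\<And>U. U \<in> \<U> \<Longrightarrow> W \<inter> U \<in> Op"
    using conjunct2[OF conjunct2[OF conjunct2[OF conjunct2[OF conjunct2[OF conjunct2[OF axioms]]]]]]
      that by simp
qed

lemma generalized_topological_spaceI:
  assumes "Op \<subseteq> Pow X" "Cov \<subseteq> Pow Op"
    "\<And>\<U>. \<U> \<subseteq> Op \<Longrightarrow> finite \<U> \<Longrightarrow> \<U> \<in> Cov"
    "\<And>\<U>. \<U> \<subseteq> Op \<Longrightarrow> finite \<U> \<Longrightarrow> \<Union>\<U> \<in> Op"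
    "\<And>\<U>. \<U> \<subseteq> Op \<Longrightarrow> finite \<U> \<Longrightarrow> X \<inter> \<Inter>\<U> \<in> Op"
    "\<And>V \<U>. V \<in> Op \<Longrightarrow> \<U> \<in> Cov \<Longrightarrow> (\<lambda>U. V \<inter> U) ` \<U> \<in> Cov"
    "\<And>\<U> \<V>. \<U> \<in> Cov \<Longrightarrow> (\<And>U. U \<in> \<U> \<Longrightarrow> \<V> U \<in> Cov \<and> \<Union>(\<V> U) = U) \<Longrightarrow> (\<Union>U\<in>\<U>. \<V> U) \<in> Cov"
    "\<And>\<U> \<W>. \<U> \<in> Cov \<Longrightarrow> \<W> \<subseteq> Op \<Longrightarrow> \<Union>\<U> = \<Union>\<W> \<Longrightarrow> (\<And>U. U \<in> \<U> \<Longrightarrow> \<exists>W\<in>\<W>. U \<subseteq> W) \<Longrightarrow> \<W> \<in> Cov"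
    "\<And>\<U> W. \<U> \<in> Cov \<Longrightarrow> W \<subseteq> \<Union>\<U> \<Longrightarrow> (\<And>U. U \<in> \<U> \<Longrightarrow> W \<inter> U \<in> Op) \<Longrightarrow> W \<in> Op"
  shows "generalized_topological_space X Op Cov"
  unfolding generalized_topological_space_def Setcompr_eq_image
proof (intro conjI allI ballI impI)
  show "\<W> \<in> Cov" if "\<U> \<in> Cov" "\<W> \<subseteq> Op" "\<Union>\<U> = \<Union>\<W> \<and> (\<forall>U\<in>\<U>. \<exists>V\<in>\<W>. U \<subseteq> V)" for \<U> \<W>
    using assms(8)[of \<U> \<W>] that by blast
  show "W \<in> Op" if "\<U> \<in> Cov" "W \<subseteq> \<Union>\<U>" "\<forall>U\<in>\<U>. W \<inter> U \<in> Op" for \<U> W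
    using assms(9)[of \<U> W] that by blast
  show "(\<Union>U\<in>\<U>. \<V> U) \<in> Cov" if "\<U> \<in> Cov" "\<forall>U\<in>\<U>. \<V> U \<in> Cov \<and> \<Union>(\<V> U) = U" for \<U> \<V>
    using assms(7)[of \<U> \<V>] that by blast
qed (use assms in auto)

lemma generalized_topological_space_Union_Cov:
  assumes "generalized_topological_space X Op Cov"
  shows "\<Union>Cov = Op"
proof -
  have "{U} \<in> Cov" if "U \<in> Op" for U
    using generalized_topological_spaceD(3)[OF assms] that by simp
  then show ?thesis using generalized_topological_spaceD(2)[OF assms] by blast
qed

lemma generalized_topological_space_carrier:
  "generalized_topological_space X Op Cov \<Longrightarrow> X \<in> Op"
  using generalized_topological_spaceD(5)[of X Op Cov "{}"] by simp

lemma generalized_topologyI: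
  "generalized_topological_space X Op Cov \<Longrightarrow> generalized_topology X Cov"
  by (simp add: generalized_topology_def generalized_topological_space_Union_Cov)

lemma istopology_Union:
  "istopology (\<lambda>U. U \<in> \<tau>) \<Longrightarrow> \<K> \<subseteq> \<tau> \<Longrightarrow> \<Union>\<K> \<in> \<tau>"
  unfolding istopology_def by blast

text \<open>
  These spaces bound generated generalized topologies from above: with \<open>\<tau> = Pow X\<close> they make the
  intersection that defines \<open>generated_gt\<close> one over a nonempty family.
\<close>

lemma generalized_topological_space_Pow:
  assumes top: "istopology (\<lambda>U. U \<in> \<tau>)" and "\<tau> \<subseteq> Pow X" "X \<in> \<tau>"
  shows "generalized_topological_space X \<tau> (Pow \<tau>)"
proof -
  have Int: "U \<inter> V \<in> \<tau>" if "U \<in> \<tau>" "V \<in> \<tau>" for U V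
    using top that unfolding istopology_def by blast
  note Un = istopology_Union[OF top]
  show ?thesis
  proof (rule generalized_topological_spaceI)
    show "X \<inter> \<Inter>\<U> \<in> \<tau>" if "\<U> \<subseteq> \<tau>" "finite \<U>" for \<U>
      using that(2,1)
    proof (induction rule: finite_induct)
      case (insert V \<U>)
      then have "V \<inter> (X \<inter> \<Inter>\<U>) \<in> \<tau>" by (simp add: Int)
      moreover have "X \<inter> \<Inter>(insert V \<U>) = V \<inter> (X \<inter> \<Inter>\<U>)" by blast
      ultimately show ?case by simp
    qed (simp add: assms)
    show "W \<in> \<tau>" if "\<U> \<in> Pow \<tau>" "W \<subseteq> \<Union>\<U>" "\<And>U. U \<in> \<U> \<Longrightarrow> W \<inter> U \<in> \<tau>" for \<U> W
    proof -
      have "\<Union>((\<lambda>U. W \<inter> U) ` \<U>) \<in> \<tau>" using that(3) by (intro Un) auto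
      moreover have "\<Union>((\<lambda>U. W \<inter> U) ` \<U>) = W" using that(2) by auto
      ultimately show ?thesis by simp
    qed
  qed (use assms Int Un in auto)
qed

text \<open>
  A set is open exactly when its singleton is a covering, so the intersection of the coverings
  determines the intersection of the open sets, and every axiom can be checked in each space
  separately.
\<close>

lemma generalized_topological_space_Inter:
  assumes "\<C> \<noteq> {}" and gt: "\<And>Cov. Cov \<in> \<C> \<Longrightarrow> generalized_topology X Cov"
  shows "generalized_topological_space X (\<Inter>Cov\<in>\<C>. \<Union>Cov) (\<Inter>\<C>)"
proof -
  note D = generalized_topological_spaceD[OF gt[unfolded generalized_topology_def]]
  show ?thesis
  proof (rule generalized_topological_spaceI)
    show "(\<Inter>Cov\<in>\<C>. \<Union>Cov) \<subseteq> Pow X" using assms(1) D(1) by blast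
    show "\<Inter>\<C> \<subseteq> Pow (\<Inter>Cov\<in>\<C>. \<Union>Cov)" by blast
    show "\<U> \<in> \<Inter>\<C>" if "\<U> \<subseteq> (\<Inter>Cov\<in>\<C>. \<Union>Cov)" "finite \<U>" for \<U>
      using that by (intro InterI D(3)) auto
    show "\<Union>\<U> \<in> (\<Inter>Cov\<in>\<C>. \<Union>Cov)" if "\<U> \<subseteq> (\<Inter>Cov\<in>\<C>. \<Union>Cov)" "finite \<U>" for \<U>
      using that by (intro INT_I D(4)) auto
    show "X \<inter> \<Inter>\<U> \<in> (\<Inter>Cov\<in>\<C>. \<Union>Cov)" if "\<U> \<subseteq> (\<Inter>Cov\<in>\<C>. \<Union>Cov)" "finite \<U>" for \<U>
      using that by (intro INT_I D(5)) auto
    show "(\<lambda>U. V \<inter> U) ` \<U> \<in> \<Inter>\<C>" if "V \<in> (\<Inter>Cov\<in>\<C>. \<Union>Cov)" "\<U> \<in> \<Inter>\<C>" for V \<U>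
      using that by (intro InterI D(6)) auto
    show "(\<Union>U\<in>\<U>. \<V> U) \<in> \<Inter>\<C>"
      if "\<U> \<in> \<Inter>\<C>" "\<And>U. U \<in> \<U> \<Longrightarrow> \<V> U \<in> \<Inter>\<C> \<and> \<Union>(\<V> U) = U" for \<U> \<V>
      using that by (intro InterI D(7)) auto
    show "\<W> \<in> \<Inter>\<C>"
      if "\<U> \<in> \<Inter>\<C>" "\<W> \<subseteq> (\<Inter>Cov\<in>\<C>. \<Union>Cov)" "\<Union>\<U> = \<Union>\<W>"
        "\<And>U. U \<in> \<U> \<Longrightarrow> \<exists>W\<in>\<W>. U \<subseteq> W" for \<U> \<W>
    proof
      fix Cov assume Cov: "Cov \<in> \<C>"
      show "\<W> \<in> Cov"
        by (rule D(8)[OF Cov _ _ that(3,4)]) (use that(1,2) Cov in auto)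
    qed
    show "W \<in> (\<Inter>Cov\<in>\<C>. \<Union>Cov)"
      if "\<U> \<in> \<Inter>\<C>" "W \<subseteq> \<Union>\<U>" "\<And>U. U \<in> \<U> \<Longrightarrow> W \<inter> U \<in> (\<Inter>Cov\<in>\<C>. \<Union>Cov)" for \<U> W
    proof
      fix Cov assume Cov: "Cov \<in> \<C>"
      show "W \<in> \<Union>Cov"
        by (rule D(9)[OF Cov _ that(2)]) (use that(1) that(3)[THEN INT_D] Cov in auto)
    qed
  qed
qed

lemma generated_gt_minimal:
  "generalized_topological_space X Op Cov \<Longrightarrow> \<Psi> \<subseteq> Cov \<Longrightarrow> generated_gt X \<Psi> \<subseteq> Cov"
  unfolding generated_gt_def by (auto intro: generalized_topologyI)

lemma subset_generated_gt: "\<Psi> \<subseteq> generated_gt X \<Psi>"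
  unfolding generated_gt_def by blast

lemma generalized_topological_space_generated_gt:
  assumes "\<Psi> \<subseteq> Pow (Pow X)"
  shows "generalized_topological_space X (\<Union>(generated_gt X \<Psi>)) (generated_gt X \<Psi>)"
proof -
  have "generalized_topology X (Pow (Pow X))"
    by (intro generalized_topologyI[of X "Pow X"] generalized_topological_space_Pow)
       (auto simp: istopology_def)
  with assms have ne: "{Cov. generalized_topology X Cov \<and> \<Psi> \<subseteq> Cov} \<noteq> {}" by blast
  from generalized_topological_space_Inter[OF ne, of X]
  have "generalized_topological_space X
      (\<Inter>Cov\<in>{Cov. generalized_topology X Cov \<and> \<Psi> \<subseteq> Cov}. \<Union>Cov) (generated_gt X \<Psi>)"
    unfolding generated_gt_def by simp
  then show ?thesis using generalized_topological_space_Union_Cov by fastforce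
qed

text \<open>
  Since this is the largest generalized topology on \<open>Y\<close> that makes \<open>f\<close> strictly continuous, strict
  continuity into a generated generalized topology need only be tested on generators.
  Distinct sets may have equal preimages, so transitivity on \<open>Y\<close> does not translate member by member
  into transitivity on \<open>X\<close>: the coverings of all sets with the same preimage are merged, and the
  merged family is a covering by saturation.
\<close>

lemma generalized_topological_space_final:
  assumes gts: "generalized_topological_space X Op Cov" and f: "f \<in> X \<rightarrow> Y"
  shows "generalized_topological_space Y {V. V \<subseteq> Y \<and> f -` V \<inter> X \<in> Op}
      {\<V>. \<V> \<subseteq> Pow Y \<and> (\<lambda>V. f -` V \<inter> X) ` \<V> \<in> Cov}"
    (is "generalized_topological_space Y ?Op ?Cov")
proof -
  note D = generalized_topological_spaceD[OF gts]
  define p where "p = (\<lambda>V. f -` V \<inter> X)"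
  have p_Union: "p (\<Union>\<U>) = \<Union>(p ` \<U>)" for \<U> by (auto simp: p_def)
  have p_mono: "U \<subseteq> V \<Longrightarrow> p U \<subseteq> p V" for U V by (auto simp: p_def)
  have p_Int: "p (U \<inter> V) = p U \<inter> p V" for U V by (auto simp: p_def)
  have Op_eq: "?Op = {V. V \<subseteq> Y \<and> p V \<in> Op}" and Cov_eq: "?Cov = {\<V>. \<V> \<subseteq> Pow Y \<and> p ` \<V> \<in> Cov}"
    by (simp_all add: p_def)
  show ?thesis
    unfolding Op_eq Cov_eq
  proof (rule generalized_topological_spaceI; (simp only: mem_Collect_eq)?)
    show "{V. V \<subseteq> Y \<and> p V \<in> Op} \<subseteq> Pow Y" by blast
    show "{\<V>. \<V> \<subseteq> Pow Y \<and> p ` \<V> \<in> Cov} \<subseteq> Pow {V. V \<subseteq> Y \<and> p V \<in> Op}"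
      using D(2) by blast
    show "\<U> \<subseteq> Pow Y \<and> p ` \<U> \<in> Cov" if "\<U> \<subseteq> {V. V \<subseteq> Y \<and> p V \<in> Op}" "finite \<U>" for \<U>
      using that D(3)[of "p ` \<U>"] by blast
    show "\<Union>\<U> \<subseteq> Y \<and> p (\<Union>\<U>) \<in> Op" if "\<U> \<subseteq> {V. V \<subseteq> Y \<and> p V \<in> Op}" "finite \<U>" for \<U>
      using that D(4)[of "p ` \<U>"] unfolding p_Union by blast
    show "Y \<inter> \<Inter>\<U> \<subseteq> Y \<and> p (Y \<inter> \<Inter>\<U>) \<in> Op"
      if "\<U> \<subseteq> {V. V \<subseteq> Y \<and> p V \<in> Op}" "finite \<U>" for \<U>
    proof -
      have "p (Y \<inter> \<Inter>\<U>) = X \<inter> \<Inter>(p ` \<U>)" using f by (auto simp: p_def)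
      then show ?thesis using that D(5)[of "p ` \<U>"] by auto
    qed
    show "(\<lambda>U. V \<inter> U) ` \<U> \<subseteq> Pow Y \<and> p ` (\<lambda>U. V \<inter> U) ` \<U> \<in> Cov"
      if "V \<subseteq> Y \<and> p V \<in> Op" "\<U> \<subseteq> Pow Y \<and> p ` \<U> \<in> Cov" for V \<U>
      using that D(6)[of "p V" "p ` \<U>"] by (auto simp: image_image p_Int)
    show "\<W> \<subseteq> Pow Y \<and> p ` \<W> \<in> Cov"
      if "\<U> \<subseteq> Pow Y \<and> p ` \<U> \<in> Cov" "\<W> \<subseteq> {V. V \<subseteq> Y \<and> p V \<in> Op}" "\<Union>\<U> = \<Union>\<W>"
        and ref: "\<And>U. U \<in> \<U> \<Longrightarrow> \<exists>W\<in>\<W>. U \<subseteq> W" for \<U> \<W>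
    proof -
      have "p ` \<W> \<in> Cov"
      proof (rule D(8))
        show "p ` \<U> \<in> Cov" "p ` \<W> \<subseteq> Op" using that by auto
        show "\<Union>(p ` \<U>) = \<Union>(p ` \<W>)" using that(3) p_Union by metis
        show "\<exists>W\<in>p ` \<W>. U \<subseteq> W" if "U \<in> p ` \<U>" for U
        proof -
          from that obtain U' where "U' \<in> \<U>" "U = p U'" by blast
          moreover from this ref obtain W where "W \<in> \<W>" "U' \<subseteq> W" by blast
          ultimately show ?thesis using p_mono[of U' W] by blast
        qed
      qed
      then show ?thesis using that(2) by blast
    qed
    show "W \<subseteq> Y \<and> p W \<in> Op"
      if "\<U> \<subseteq> Pow Y \<and> p ` \<U> \<in> Cov" "W \<subseteq> \<Union>\<U>"
        and loc: "\<And>U. U \<in> \<U> \<Longrightarrow> W \<inter> U \<subseteq> Y \<and> p (W \<inter> U) \<in> Op" for \<U> W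
    proof -
      have "p W \<in> Op"
      proof (rule D(9))
        show "p ` \<U> \<in> Cov" using that by blast
        show "p W \<subseteq> \<Union>(p ` \<U>)" using p_mono[OF that(2)] p_Union by metis
        show "p W \<inter> U \<in> Op" if "U \<in> p ` \<U>" for U
          using that loc p_Int by auto
      qed
      then show ?thesis using that(1,2) by blast
    qed
    show "(\<Union>U\<in>\<U>. \<V> U) \<subseteq> Pow Y \<and> p ` (\<Union>U\<in>\<U>. \<V> U) \<in> Cov"
      if \<U>: "\<U> \<subseteq> Pow Y \<and> p ` \<U> \<in> Cov"
        and \<V>: "\<And>U. U \<in> \<U> \<Longrightarrow> (\<V> U \<subseteq> Pow Y \<and> p ` \<V> U \<in> Cov) \<and> \<Union>(\<V> U) = U" for \<U> \<V>
    proof -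
      \<comment> \<open>Merge the coverings of all members of \<open>\<U>\<close> that have the preimage \<open>A\<close>.\<close>
      define \<V>' where "\<V>' = (\<lambda>A. \<Union>U\<in>{U\<in>\<U>. p U = A}. p ` \<V> U)"
      have Union_\<V>: "\<Union>(p ` \<V> U) = p U" if "U \<in> \<U>" for U using \<V>[OF that] p_Union by metis
      have "\<V>' A \<in> Cov \<and> \<Union>(\<V>' A) = A" if "A \<in> p ` \<U>" for A
      proof -
        from that obtain U where U: "U \<in> \<U>" "p U = A" by blast
        have "\<Union>(\<V>' A) = (\<Union>U\<in>{U\<in>\<U>. p U = A}. \<Union>(p ` \<V> U))" unfolding \<V>'_def by auto
        also have "\<dots> = (\<Union>U\<in>{U\<in>\<U>. p U = A}. A)"
          by (rule SUP_cong[OF refl]) (simp only: mem_Collect_eq Union_\<V>)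
        also have "\<dots> = A" using U by auto
        finally have eq: "\<Union>(\<V>' A) = A" .
        have "\<V>' A \<in> Cov"
        proof (rule D(8))
          \<comment> \<open>One of the merged coverings already covers \<open>A\<close> and refines the merged family.\<close>
          show "p ` \<V> U \<in> Cov" using \<V>[OF U(1)] by blast
          show "\<V>' A \<subseteq> Op"
          proof
            fix T assume "T \<in> \<V>' A"
            then obtain U' where "U' \<in> \<U>" "T \<in> p ` \<V> U'" unfolding \<V>'_def by blast
            moreover from this have "p ` \<V> U' \<in> Cov" using \<V> by simp
            ultimately show "T \<in> Op" using D(2) by blast
          qed
          show "\<Union>(p ` \<V> U) = \<Union>(\<V>' A)" using Union_\<V>[OF U(1)] U(2) eq by simp
          show "\<exists>W\<in>\<V>' A. T \<subseteq> W" if "T \<in> p ` \<V> U" for T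
            using that U unfolding \<V>'_def by blast
        qed
        with eq show ?thesis by blast
      qed
      then have "(\<Union>A\<in>p ` \<U>. \<V>' A) \<in> Cov"
        using \<U> D(7)[of "p ` \<U>" \<V>'] by simp
      moreover have "(\<Union>A\<in>p ` \<U>. \<V>' A) = p ` (\<Union>U\<in>\<U>. \<V> U)" unfolding \<V>'_def by auto
      moreover have "(\<Union>U\<in>\<U>. \<V> U) \<subseteq> Pow Y" using \<V> by (intro UN_least) simp
      ultimately show ?thesis by (simp only:)
    qed
  qed
qed

lemma istopology_top_gen: "istopology (\<lambda>U. U \<in> top_gen \<A>)"
  unfolding top_gen_def by simp

lemma subset_top_gen: "\<A> \<subseteq> top_gen \<A>"
  unfolding top_gen_def by (auto intro: topology_generated_by_Basis)

lemma top_gen_minimal: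
  assumes "istopology (\<lambda>U. U \<in> \<tau>)" "\<A> \<subseteq> \<tau>"
  shows "top_gen \<A> \<subseteq> \<tau>"
proof
  fix U assume "U \<in> top_gen \<A>"
  then have "generate_topology_on \<A> U" by (simp add: top_gen_def openin_topology_generated_by_iff)
  then show "U \<in> \<tau>"
    by induction (use assms in \<open>auto simp: istopology_def\<close>)
qed

lemma top_gen_subset_Pow: "\<A> \<subseteq> Pow X \<Longrightarrow> top_gen \<A> \<subseteq> Pow X"
  by (rule top_gen_minimal) (auto simp: istopology_def)

lemma vimage_top_gen:
  assumes "\<And>V. V \<in> \<B> \<Longrightarrow> f -` V \<inter> X \<in> \<A>" "V \<in> top_gen \<B>"
  shows "f -` V \<inter> X \<in> top_gen \<A>"
proof -
  have "istopology (\<lambda>V. V \<in> {V. f -` V \<inter> X \<in> top_gen \<A>})"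
    unfolding istopology_def
  proof (intro conjI allI impI)
    fix S T assume "S \<in> {V. f -` V \<inter> X \<in> top_gen \<A>}" "T \<in> {V. f -` V \<inter> X \<in> top_gen \<A>}"
    then have "(f -` S \<inter> X) \<inter> (f -` T \<inter> X) \<in> top_gen \<A>"
      using istopology_top_gen[of \<A>] unfolding istopology_def by blast
    moreover have "(f -` S \<inter> X) \<inter> (f -` T \<inter> X) = f -` (S \<inter> T) \<inter> X" by auto
    ultimately show "S \<inter> T \<in> {V. f -` V \<inter> X \<in> top_gen \<A>}" by simp
  next
    fix \<K> assume "\<forall>K\<in>\<K>. K \<in> {V. f -` V \<inter> X \<in> top_gen \<A>}"
    then have "(\<Union>K\<in>\<K>. f -` K \<inter> X) \<in> top_gen \<A>"
      by (intro istopology_Union[OF istopology_top_gen]) auto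
    then show "\<Union>\<K> \<in> {V. f -` V \<inter> X \<in> top_gen \<A>}" by (simp add: vimage_Union)
  qed
  moreover have "\<B> \<subseteq> {V. f -` V \<inter> X \<in> top_gen \<A>}" using assms(1) subset_top_gen by blast
  ultimately show ?thesis using top_gen_minimal assms(2) by blast
qed

section \<open>Partial topologization of generalized topological spaces\<close>

lemma Obj_GTS: "(X, Op, Cov) \<in> Obj GTS \<longleftrightarrow> generalized_topological_space X Op Cov"
  by (simp add: GTS_def)

lemma Und_GTS: "Und GTS A = fst A"
  by (simp add: GTS_def)

lemma Hom_GTS: "f \<in> Hom GTS (X, OpX, CovX) (Y, OpY, CovY) \<longleftrightarrow>
    f \<in> X \<rightarrow>\<^sub>E Y \<and> (\<forall>\<V>\<in>CovY. (\<lambda>V. f -` V \<inter> X) ` \<V> \<in> CovX)"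
  by (simp add: GTS_def strictly_continuous_def Setcompr_eq_image)

lemma concrete_category_GTS: "concrete_category GTS"
  unfolding concrete_category_def
proof (intro conjI ballI)
  fix A B :: "'a gts" show "Hom GTS A B \<subseteq> (Und GTS A \<rightarrow>\<^sub>E Und GTS B)"
    by (cases A; cases B) (auto simp: Hom_GTS Und_GTS)
next
  fix A :: "'a gts" assume A: "A \<in> Obj GTS"
  obtain X Op Cov where [simp]: "A = (X, Op, Cov)" by (cases A)
  note D = generalized_topological_spaceD[of X Op Cov]
  have "(\<lambda>V. ident_map X -` V \<inter> X) ` \<V> = \<V>" if "\<V> \<in> Cov" for \<V>
  proof -
    have "ident_map X -` V \<inter> X = V" if "V \<in> \<V>" for V
      using D(1,2) A that \<open>\<V> \<in> Cov\<close> by (intro vimage_ident_map) (auto simp: Obj_GTS)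
    then show ?thesis by simp
  qed
  then show "ident_map (Und GTS A) \<in> Hom GTS A A"
    by (simp add: Hom_GTS Und_GTS ident_map_PiE)
next
  fix A B D :: "'a gts" and f g assume f: "f \<in> Hom GTS A B" and g: "g \<in> Hom GTS B D"
  obtain X OpX CovX Y OpY CovY Z OpZ CovZ
    where [simp]: "A = (X, OpX, CovX)" "B = (Y, OpY, CovY)" "D = (Z, OpZ, CovZ)"
    by (cases A; cases B; cases D)
  have fg: "f \<in> X \<rightarrow>\<^sub>E Y" "g \<in> Y \<rightarrow>\<^sub>E Z" using f g by (simp_all add: Hom_GTS)
  have vim: "compose X g f -` V \<inter> X = f -` (g -` V \<inter> Y) \<inter> X" for V
    using fg(1) by (intro vimage_compose) auto
  have "(\<lambda>V. compose X g f -` V \<inter> X) ` \<V> \<in> CovX" if "\<V> \<in> CovZ" for \<V>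
  proof -
    have "(\<lambda>V. f -` V \<inter> X) ` (\<lambda>V. g -` V \<inter> Y) ` \<V> \<in> CovX"
      using f g that by (simp add: Hom_GTS)
    then show ?thesis by (simp add: vim image_image)
  qed
  then show "compose (Und GTS A) g f \<in> Hom GTS A D"
    using compose_PiE[OF fg] by (simp add: Hom_GTS Und_GTS)
qed

lemma Obj_GTS_pt: "(X, Op, Cov) \<in> Obj GTS_pt \<longleftrightarrow>
    generalized_topological_space X Op Cov \<and> istopology (\<lambda>U. U \<in> Op)"
  by (simp add: GTS_pt_def full_subcat_def partially_topological_gts_def Obj_GTS)

lemma GTS_pt_simps [simp]: "Und GTS_pt = Und GTS" "Hom GTS_pt = Hom GTS"
  by (simp_all add: GTS_pt_def full_subcat_def)

lemma concrete_category_GTS_pt: "concrete_category GTS_pt"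
  unfolding GTS_pt_def by (rule concrete_category_full_subcat[OF concrete_category_GTS])

lemma EssFin_subset: "EssFin X \<U> \<subseteq> Pow \<U>"
  by (auto simp: EssFin_iff)

text \<open>
  Adjoining the essentially finite families in \<open>top_gen Op\<close> forces every member of \<open>top_gen Op\<close> to
  become open. No further open sets arise, since all families of members of \<open>top_gen Op\<close> together
  form a generalized topology that contains the generators.
\<close>

lemma pt_gts_space:
  assumes gts: "generalized_topological_space X Op Cov"
  defines "G \<equiv> generated_gt X (Cov \<union> EssFin X (top_gen Op))"
  shows "generalized_topological_space X (top_gen Op) G"
proof -
  note D = generalized_topological_spaceD[OF gts]
  have top_X: "top_gen Op \<subseteq> Pow X" by (rule top_gen_subset_Pow[OF D(1)])
  have sub: "Cov \<union> EssFin X (top_gen Op) \<subseteq> Pow (top_gen Op)"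
    using D(2) subset_top_gen[of Op] EssFin_subset[of X "top_gen Op"] by blast
  have "generalized_topological_space X (\<Union>G) G"
    unfolding G_def using sub top_X by (intro generalized_topological_space_generated_gt) blast
  moreover have "\<Union>G = top_gen Op"
  proof
    have "G \<subseteq> Pow (top_gen Op)"
      unfolding G_def
      using generalized_topological_space_Pow[OF istopology_top_gen top_X]
        generalized_topological_space_carrier[OF gts] subset_top_gen sub
      by (intro generated_gt_minimal) auto
    then show "\<Union>G \<subseteq> top_gen Op" by blast
    have "{U} \<in> G" if "U \<in> top_gen Op" for U
      using that subset_generated_gt[of "Cov \<union> EssFin X (top_gen Op)" X]
        finite_essentially_finite_on[of "{U}" X]
      unfolding G_def by (auto simp: EssFin_iff)
    then show "top_gen Op \<subseteq> \<Union>G" by blast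
  qed
  ultimately show ?thesis by simp
qed

lemma pt_gts_eq:
  assumes "generalized_topological_space X Op Cov"
  shows "pt_gts (X, Op, Cov) =
    (X, top_gen Op, generated_gt X (Cov \<union> EssFin X (top_gen Op)))"
  using generalized_topological_space_Union_Cov[OF pt_gts_space[OF assms]]
  by (simp add: pt_gts_def gts_of_cov_def)

text \<open>
  Generators pull back to generators: coverings by hypothesis, and essentially finite families of
  sets in the generated topology because preimages commute with unions and finite intersections.
\<close>

lemma strictly_continuous_pt_gts:
  assumes X: "generalized_topological_space X OpX CovX"
    and Y: "generalized_topological_space Y OpY CovY"
    and f: "f \<in> X \<rightarrow> Y"
    and cont: "\<And>\<V>. \<V> \<in> CovY \<Longrightarrow> (\<lambda>V. f -` V \<inter> X) ` \<V> \<in> CovX"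
    and \<V>: "\<V> \<in> generated_gt Y (CovY \<union> EssFin Y (top_gen OpY))"
  shows "(\<lambda>V. f -` V \<inter> X) ` \<V> \<in> generated_gt X (CovX \<union> EssFin X (top_gen OpX))"
proof -
  let ?p = "\<lambda>V. f -` V \<inter> X"
  let ?G = "generated_gt X (CovX \<union> EssFin X (top_gen OpX))"
  note DY = generalized_topological_spaceD[OF Y]
  have gen: "CovX \<union> EssFin X (top_gen OpX) \<subseteq> ?G" by (rule subset_generated_gt)
  have open_Y: "?p V \<in> OpX" if "V \<in> OpY" for V
  proof -
    have "?p ` {V} \<in> CovX" using DY(3)[of "{V}"] that by (intro cont) auto
    then show ?thesis using generalized_topological_spaceD(2)[OF X] by auto
  qed
  have "CovY \<union> EssFin Y (top_gen OpY) \<subseteq> {\<V>. \<V> \<subseteq> Pow Y \<and> ?p ` \<V> \<in> ?G}"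
  proof (rule Un_least; rule subsetI)
    fix \<W> assume "\<W> \<in> CovY"
    then show "\<W> \<in> {\<V>. \<V> \<subseteq> Pow Y \<and> ?p ` \<V> \<in> ?G}" using DY(1,2) cont[of \<W>] gen by blast
  next
    fix \<W> assume "\<W> \<in> EssFin Y (top_gen OpY)"
    then have \<W>: "\<W> \<subseteq> top_gen OpY" "essentially_finite_on \<W> Y" by (auto simp: EssFin_iff)
    have "\<W> \<subseteq> Pow Y" using \<W>(1) top_gen_subset_Pow[OF DY(1)] by blast
    moreover have "?p ` \<W> \<in> EssFin X (top_gen OpX)"
      unfolding EssFin_iff
    proof
      show "?p ` \<W> \<subseteq> top_gen OpX" using vimage_top_gen[of OpY f X OpX, OF open_Y] \<W>(1) by blast
      show "essentially_finite_on (?p ` \<W>) X"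
        using f by (intro essentially_finite_on_vimage[OF \<W>(2)]) auto
    qed
    ultimately show "\<W> \<in> {\<V>. \<V> \<subseteq> Pow Y \<and> ?p ` \<V> \<in> ?G}" using gen by blast
  qed
  with generated_gt_minimal generalized_topological_space_final[OF pt_gts_space[OF X] f]
  show ?thesis using \<V> by blast
qed

lemma concrete_functor_pt_gts: "concrete_functor GTS GTS_pt pt_gts"
  unfolding concrete_functor_def
proof (intro conjI ballI subsetI)
  show "concrete_category GTS" by (rule concrete_category_GTS)
  show "concrete_category GTS_pt" by (rule concrete_category_GTS_pt)
next
  fix A :: "'a gts" assume "A \<in> Obj GTS"
  then show "pt_gts A \<in> Obj GTS_pt" "Und GTS_pt (pt_gts A) = Und GTS A"
    by (cases A; auto simp: Obj_GTS Obj_GTS_pt pt_gts_eq pt_gts_space istopology_top_gen Und_GTS)+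
next
  fix A B :: "'a gts" and f
  assume A: "A \<in> Obj GTS" and B: "B \<in> Obj GTS" and f: "f \<in> Hom GTS A B"
  obtain X OpX CovX Y OpY CovY where [simp]: "A = (X, OpX, CovX)" "B = (Y, OpY, CovY)"
    by (cases A; cases B)
  have gts: "generalized_topological_space X OpX CovX" "generalized_topological_space Y OpY CovY"
    using A B by (simp_all add: Obj_GTS)
  have f': "f \<in> X \<rightarrow>\<^sub>E Y" "\<And>\<V>. \<V> \<in> CovY \<Longrightarrow> (\<lambda>V. f -` V \<inter> X) ` \<V> \<in> CovX"
    using f by (simp_all add: Hom_GTS)
  then have "f \<in> X \<rightarrow> Y" by (simp add: PiE_iff Pi_iff)
  with f' show "f \<in> Hom GTS_pt (pt_gts A) (pt_gts B)"
    using strictly_continuous_pt_gts[OF gts] by (simp add: pt_gts_eq gts Hom_GTS)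
qed

section \<open>Locally small spaces as generalized topological spaces\<close>

text \<open>
  Each axiom is verified on one \<open>L \<in> \<L>\<close> at a time, where finitely many members of an admissible family
  suffice. In the regularity axiom this exhibits \<open>W \<inter> L\<close> as a finite union of members of \<open>\<L>\<close>.
\<close>

lemma generalized_topological_space_EF:
  assumes lss: "locally_small_space X \<L>"
  shows "generalized_topological_space X (opens X \<L>) (EF (opens X \<L>) \<L>)"
proof (rule generalized_topological_spaceI)
  show "opens X \<L> \<subseteq> Pow X" by (auto dest: opensD(2))
  show "EF (opens X \<L>) \<L> \<subseteq> Pow (opens X \<L>)" by (auto simp: EF_iff)
  show "\<U> \<in> EF (opens X \<L>) \<L>" if "\<U> \<subseteq> opens X \<L>" "finite \<U>" for \<U>
    using that by (simp add: EF_iff finite_essentially_finite_on)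
  show "\<Union>\<U> \<in> opens X \<L>" if "\<U> \<subseteq> opens X \<L>" "finite \<U>" for \<U>
    using opens_finite_Union[OF lss that(2,1)] .
  show "X \<inter> \<Inter>\<U> \<in> opens X \<L>" if "\<U> \<subseteq> opens X \<L>" "finite \<U>" for \<U>
    using opens_finite_Inter[OF lss that(2,1)] .
  show "(\<lambda>U. V \<inter> U) ` \<U> \<in> EF (opens X \<L>) \<L>"
    if V: "V \<in> opens X \<L>" and \<U>: "\<U> \<in> EF (opens X \<L>) \<L>" for V \<U>
    unfolding EF_iff
  proof (intro conjI ballI)
    show "(\<lambda>U. V \<inter> U) ` \<U> \<subseteq> opens X \<L>" using V \<U> by (auto simp: EF_iff intro: opens_Int)
    fix L assume "L \<in> \<L>"
    then obtain \<F> where "\<F> \<subseteq> \<U>" "finite \<F>" "\<Union>\<U> \<inter> L \<subseteq> \<Union>\<F>"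
      by (rule EF_finite_cover[OF \<U>])
    then show "essentially_finite_on ((\<lambda>U. V \<inter> U) ` \<U>) L"
      by (intro essentially_finite_onI[of "(\<lambda>U. V \<inter> U) ` \<F>"]) auto
  qed
  show "(\<Union>U\<in>\<U>. \<V> U) \<in> EF (opens X \<L>) \<L>"
    if \<U>: "\<U> \<in> EF (opens X \<L>) \<L>"
      and \<V>: "\<And>U. U \<in> \<U> \<Longrightarrow> \<V> U \<in> EF (opens X \<L>) \<L> \<and> \<Union>(\<V> U) = U" for \<U> \<V>
    unfolding EF_iff
  proof (intro conjI ballI)
    show "(\<Union>U\<in>\<U>. \<V> U) \<subseteq> opens X \<L>" using \<V> by (intro UN_least) (simp add: EF_iff)
    fix L assume L: "L \<in> \<L>"
    obtain \<F> where \<F>: "\<F> \<subseteq> \<U>" "finite \<F>" "\<Union>\<U> \<inter> L \<subseteq> \<Union>\<F>"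
      by (rule EF_finite_cover[OF \<U> L])
    have "\<exists>\<G>\<subseteq>\<V> U. finite \<G> \<and> U \<inter> L \<subseteq> \<Union>\<G>" if "U \<in> \<F>" for U
    proof -
      have U: "\<V> U \<in> EF (opens X \<L>) \<L>" "\<Union>(\<V> U) = U" using \<V>[of U] that \<F>(1) by auto
      obtain \<G> where "\<G> \<subseteq> \<V> U" "finite \<G>" "\<Union>(\<V> U) \<inter> L \<subseteq> \<Union>\<G>"
        by (rule EF_finite_cover[OF U(1) L])
      then show ?thesis using U(2) by auto
    qed
    then obtain \<G> where \<G>: "\<And>U. U \<in> \<F> \<Longrightarrow> \<G> U \<subseteq> \<V> U \<and> finite (\<G> U) \<and> U \<inter> L \<subseteq> \<Union>(\<G> U)"
      by metis
    show "essentially_finite_on (\<Union>U\<in>\<U>. \<V> U) L"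
    proof (rule essentially_finite_onI)
      show "(\<Union>U\<in>\<F>. \<G> U) \<subseteq> (\<Union>U\<in>\<U>. \<V> U)" using \<G> \<F>(1) by blast
      show "finite (\<Union>U\<in>\<F>. \<G> U)" using \<G> \<F>(2) by blast
      show "\<Union>(\<Union>U\<in>\<U>. \<V> U) \<inter> L \<subseteq> \<Union>(\<Union>U\<in>\<F>. \<G> U)"
      proof
        fix x assume x: "x \<in> \<Union>(\<Union>U\<in>\<U>. \<V> U) \<inter> L"
        then obtain U where "U \<in> \<U>" "x \<in> \<Union>(\<V> U)" by blast
        then have "x \<in> \<Union>\<U>" using \<V>[of U] by auto
        then obtain U' where "U' \<in> \<F>" "x \<in> U'" using x \<F>(3) by blast
        then show "x \<in> \<Union>(\<Union>U\<in>\<F>. \<G> U)" using \<G>[of U'] x by blast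
      qed
    qed
  qed
  show "\<W> \<in> EF (opens X \<L>) \<L>"
    if \<U>: "\<U> \<in> EF (opens X \<L>) \<L>" and \<W>: "\<W> \<subseteq> opens X \<L>" "\<Union>\<U> = \<Union>\<W>"
      and ref: "\<And>U. U \<in> \<U> \<Longrightarrow> \<exists>W\<in>\<W>. U \<subseteq> W" for \<U> \<W>
    unfolding EF_iff
  proof (intro conjI ballI)
    show "\<W> \<subseteq> opens X \<L>" by fact
    fix L assume "L \<in> \<L>"
    then obtain \<F> where \<F>: "\<F> \<subseteq> \<U>" "finite \<F>" "\<Union>\<U> \<inter> L \<subseteq> \<Union>\<F>"
      by (rule EF_finite_cover[OF \<U>])
    from ref obtain w where w: "\<And>U. U \<in> \<U> \<Longrightarrow> w U \<in> \<W> \<and> U \<subseteq> w U" by metis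
    show "essentially_finite_on \<W> L"
    proof (rule essentially_finite_onI)
      show "w ` \<F> \<subseteq> \<W>" "finite (w ` \<F>)" using w \<F> by auto
      show "\<Union>\<W> \<inter> L \<subseteq> \<Union>(w ` \<F>)"
      proof
        fix x assume "x \<in> \<Union>\<W> \<inter> L"
        then obtain U where "U \<in> \<F>" "x \<in> U" using \<F>(3) \<W>(2) by blast
        then show "x \<in> \<Union>(w ` \<F>)" using w[of U] \<F>(1) by blast
      qed
    qed
  qed
  show "W \<in> opens X \<L>"
    if \<U>: "\<U> \<in> EF (opens X \<L>) \<L>" and W: "W \<subseteq> \<Union>\<U>"
      and loc: "\<And>U. U \<in> \<U> \<Longrightarrow> W \<inter> U \<in> opens X \<L>" for \<U> W
  proof (rule opensI)
    show "W \<subseteq> X"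
    proof
      fix x assume "x \<in> W"
      then obtain U where "U \<in> \<U>" "x \<in> W \<inter> U" using W by blast
      then show "x \<in> X" using opensD(2)[OF loc] by blast
    qed
    fix L assume L: "L \<in> \<L>"
    obtain \<F> where \<F>: "\<F> \<subseteq> \<U>" "finite \<F>" "\<Union>\<U> \<inter> L \<subseteq> \<Union>\<F>"
      by (rule EF_finite_cover[OF \<U> L])
    have "\<Union>((\<lambda>U. W \<inter> U \<inter> L) ` \<F>) \<in> \<L>"
      using \<F>(1,2) loc L by (intro locally_small_space_finite_Union[OF lss]) (use opensD(1) in blast)+
    moreover have "\<Union>((\<lambda>U. W \<inter> U \<inter> L) ` \<F>) = W \<inter> L" using W \<F>(3) by blast
    ultimately show "W \<inter> L \<in> \<L>" by simp
  qed
qed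

text \<open>
  The family \<open>\<L>\<close> covers \<open>X\<close>, and on \<open>L \<in> \<L>\<close> its single member \<open>L\<close> suffices. This covering is the
  one that recovers \<open>\<L>\<close> and boundedness from the generalized topology.
\<close>

lemma smops_in_EF:
  assumes "locally_small_space X \<L>"
  shows "\<L> \<in> EF (opens X \<L>) \<L>"
  unfolding EF_iff
proof (intro conjI ballI)
  show "\<L> \<subseteq> opens X \<L>" by (rule subset_opens[OF assms])
  show "essentially_finite_on \<L> L" if "L \<in> \<L>" for L
    using that by (intro essentially_finite_onI[of "{L}"]) auto
qed

text \<open>
  Essential finiteness of the covering \<open>\<L>\<close> on \<open>K\<close> puts \<open>K\<close> inside a finite union of members of \<open>\<L>\<close>, which
  belongs to \<open>\<L>\<close>. An open set inside a member of \<open>\<L>\<close> is itself a member. As the right-hand side refers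
  to \<open>\<L>\<close> only through the open sets and the coverings, the generalized topological space
  determines \<open>\<L>\<close>.
\<close>

lemma smops_eq_quasicompact_opens:
  assumes lss: "locally_small_space X \<L>"
  shows "\<L> = {K \<in> opens X \<L>. \<forall>\<U>\<in>EF (opens X \<L>) \<L>. essentially_finite_on \<U> K}"
proof
  show "\<L> \<subseteq> {K \<in> opens X \<L>. \<forall>\<U>\<in>EF (opens X \<L>) \<L>. essentially_finite_on \<U> K}"
    using subset_opens[OF lss] by (auto simp: EF_iff)
  show "{K \<in> opens X \<L>. \<forall>\<U>\<in>EF (opens X \<L>) \<L>. essentially_finite_on \<U> K} \<subseteq> \<L>"
  proof clarify
    fix K assume K: "K \<in> opens X \<L>" "\<forall>\<U>\<in>EF (opens X \<L>) \<L>. essentially_finite_on \<U> K"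
    then have "essentially_finite_on \<L> K" using smops_in_EF[OF lss] by blast
    then obtain \<F> where \<F>: "\<F> \<subseteq> \<L>" "finite \<F>" "\<Union>\<L> \<inter> K \<subseteq> \<Union>\<F>"
      by (rule essentially_finite_onE)
    have "K \<inter> \<Union>\<F> \<in> \<L>"
      using opensD(1)[OF K(1)] locally_small_space_finite_Union[OF lss \<F>(2,1)] by blast
    moreover have "K \<inter> \<Union>\<F> = K"
      using \<F>(3) opensD(2)[OF K(1)] locally_small_spaceD(5)[OF lss] by blast
    ultimately show "K \<in> \<L>" by simp
  qed
qed

text \<open>
  Continuity of a strictly continuous map is seen on coverings by a single set \<open>M\<close>. Boundedness comes
  from the preimage of the covering \<open>\<M>\<close>: on \<open>L\<close> finitely many members suffice, and their union in \<open>Y\<close>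
  is again in \<open>\<M>\<close>.
\<close>

lemma Hom_gts_of_lss:
  assumes A: "A \<in> Obj LSS" and B: "B \<in> Obj LSS"
  shows "Hom LSS A B = Hom GTS (gts_of_lss A) (gts_of_lss B)"
proof -
  obtain X \<L> Y \<M> where [simp]: "A = (X, \<L>)" "B = (Y, \<M>)" by (cases A; cases B)
  have lss: "locally_small_space X \<L>" "locally_small_space Y \<M>"
    using A B by (simp_all add: Obj_LSS)
  let ?CX = "EF (opens X \<L>) \<L>" and ?CY = "EF (opens Y \<M>) \<M>"
  have "bounded_map X \<L> \<M> f \<and> lss_continuous X \<L> \<M> f \<longleftrightarrow>
      (\<forall>\<V>\<in>?CY. (\<lambda>V. f -` V \<inter> X) ` \<V> \<in> ?CX)" (is "?l \<longleftrightarrow> ?r")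
    if f: "f \<in> X \<rightarrow>\<^sub>E Y" for f
  proof
    assume l: ?l
    show ?r
      unfolding EF_iff[of _ "opens X \<L>"]
    proof (intro ballI conjI)
      fix \<V> assume \<V>: "\<V> \<in> ?CY"
      show "(\<lambda>V. f -` V \<inter> X) ` \<V> \<subseteq> opens X \<L>"
        using \<V> l vimage_opens[of X \<L> \<M> f _ Y] by (auto simp: EF_iff)
      fix L assume "L \<in> \<L>"
      with l obtain M where "M \<in> \<M>" "L \<subseteq> f -` M \<inter> X" unfolding bounded_map_def by blast
      then show "essentially_finite_on ((\<lambda>V. f -` V \<inter> X) ` \<V>) L"
        using \<V> by (intro essentially_finite_on_vimage[of \<V> M]) (auto simp: EF_iff)
    qed
  next
    assume r: ?r
    have "bounded_map X \<L> \<M> f"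
      unfolding bounded_map_def
    proof
      fix L assume L: "L \<in> \<L>"
      have "essentially_finite_on ((\<lambda>V. f -` V \<inter> X) ` \<M>) L"
        using r smops_in_EF[OF lss(2)] L by (simp add: EF_iff)
      then obtain \<F> where \<F>: "\<F> \<subseteq> (\<lambda>V. f -` V \<inter> X) ` \<M>" "finite \<F>"
        "\<Union>((\<lambda>V. f -` V \<inter> X) ` \<M>) \<inter> L \<subseteq> \<Union>\<F>" by (rule essentially_finite_onE)
      obtain \<G> where \<G>: "\<G> \<subseteq> \<M>" "finite \<G>" "\<F> = (\<lambda>V. f -` V \<inter> X) ` \<G>"
        using finite_subset_image[OF \<F>(2,1)] by blast
      have "\<Union>((\<lambda>V. f -` V \<inter> X) ` \<M>) = X"
        using f locally_small_spaceD(5)[OF lss(2)] by (auto simp: PiE_iff)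
      then have "L \<subseteq> \<Union>\<F>" using \<F>(3) locally_small_spaceD(1)[OF lss(1) L] by (simp add: Int_absorb1)
      then have "L \<subseteq> f -` \<Union>\<G> \<inter> X" unfolding \<G>(3) by blast
      with locally_small_space_finite_Union[OF lss(2) \<G>(2,1)]
      show "\<exists>M\<in>\<M>. L \<subseteq> f -` M \<inter> X" by (rule bexI[rotated])
    qed
    moreover have "lss_continuous X \<L> \<M> f"
      unfolding lss_continuous_def
    proof
      fix M assume "M \<in> \<M>"
      then have "{M} \<in> ?CY"
        using subset_opens[OF lss(2)] by (auto simp: EF_iff finite_essentially_finite_on)
      then have "(\<lambda>V. f -` V \<inter> X) ` {M} \<in> ?CX" using r by blast
      then show "f -` M \<inter> X \<in> opens X \<L>" by (simp add: EF_iff)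
    qed
    ultimately show ?l by blast
  qed
  note equiv = this
  show ?thesis
  proof (rule set_eqI)
    fix f
    show "f \<in> Hom LSS A B \<longleftrightarrow> f \<in> Hom GTS (gts_of_lss A) (gts_of_lss B)"
      using equiv[of f] by (simp add: gts_of_lss_def Hom_GTS Hom_LSS) blast
  qed
qed

lemma gts_of_lss_in_GTS: "A \<in> Obj LSS \<Longrightarrow> gts_of_lss A \<in> Obj GTS"
  by (cases A) (simp add: Obj_LSS gts_of_lss_def Obj_GTS generalized_topological_space_EF)

lemma fst_gts_of_lss: "fst (gts_of_lss A) = fst A"
  by (simp add: gts_of_lss_def split: prod.split)

lemma inj_on_gts_of_lss: "inj_on gts_of_lss (Obj LSS)"
proof (rule inj_onI)
  fix A B :: "'a lss"
  assume A: "A \<in> Obj LSS" and B: "B \<in> Obj LSS" and eq: "gts_of_lss A = gts_of_lss B"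
  obtain X \<L> Y \<M> where AB: "A = (X, \<L>)" "B = (Y, \<M>)" by (cases A; cases B)
  have lss: "locally_small_space X \<L>" "locally_small_space Y \<M>"
    using A B by (simp_all add: AB Obj_LSS)
  have eqs: "X = Y" "opens X \<L> = opens Y \<M>" "EF (opens X \<L>) \<L> = EF (opens Y \<M>) \<M>"
    using eq unfolding AB gts_of_lss_def split_conv prod.inject by blast+
  have "\<L> = {K \<in> opens X \<L>. \<forall>\<U>\<in>EF (opens X \<L>) \<L>. essentially_finite_on \<U> K}"
    by (rule smops_eq_quasicompact_opens[OF lss(1)])
  also have "\<dots> = {K \<in> opens Y \<M>. \<forall>\<U>\<in>EF (opens Y \<M>) \<M>. essentially_finite_on \<U> K}"
    unfolding eqs(3) by (simp only: eqs(2))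
  also have "\<dots> = \<M>" by (rule smops_eq_quasicompact_opens[OF lss(2), symmetric])
  finally show "A = B" by (simp add: AB eqs(1))
qed

lemma full_concrete_embedding_LSS: "full_concrete_embedding LSS GTS gts_of_lss"
  unfolding full_concrete_embedding_def concrete_functor_def
  by (simp add: concrete_category_LSS concrete_category_GTS inj_on_gts_of_lss gts_of_lss_in_GTS
      Und_LSS Und_GTS fst_gts_of_lss Hom_gts_of_lss)

lemma istopology_weak_opens:
  "locally_small_space X \<L> \<Longrightarrow> istopology (\<lambda>U. U \<in> weak_opens \<L>)"
  unfolding istopology_def using weak_opens_Int weak_opens_Union by (metis subsetI)

lemma gts_of_lss_in_GTS_pt:
  assumes "A \<in> Obj LSS_pt"
  shows "gts_of_lss A \<in> Obj GTS_pt"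
proof -
  obtain X \<L> where A: "A = (X, \<L>)" by (cases A)
  have lss: "locally_small_space X \<L>" and pt: "small_weak_opens X \<L> = \<L>"
    using assms by (simp_all add: A Obj_LSS_pt Obj_LSS pt_lss_def)
  have "opens X \<L> = weak_opens \<L>" using opens_small_weak_opens[OF lss] pt by simp
  then show ?thesis
    using generalized_topological_space_EF[OF lss] istopology_weak_opens[OF lss]
    by (simp add: A gts_of_lss_def Obj_GTS_pt)
qed

lemma full_concrete_embedding_LSS_pt: "full_concrete_embedding LSS_pt GTS_pt gts_of_lss"
proof -
  have sub: "Obj LSS_pt \<subseteq> Obj LSS" by (auto simp: Obj_LSS_pt)
  show ?thesis
    unfolding full_concrete_embedding_def concrete_functor_def
    by (simp add: concrete_category_LSS_pt concrete_category_GTS_pt gts_of_lss_in_GTS_pt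
        inj_on_subset[OF inj_on_gts_of_lss sub] Und_LSS Und_GTS fst_gts_of_lss Hom_gts_of_lss
        subsetD[OF sub])
qed

section \<open>Agreement of the two partial topologizations\<close>

lemma top_gen_opens:
  assumes "locally_small_space X \<L>"
  shows "top_gen (opens X \<L>) = weak_opens \<L>"
proof
  show "top_gen (opens X \<L>) \<subseteq> weak_opens \<L>"
    using istopology_weak_opens[OF assms] opens_subset_weak_opens[OF assms]
    by (rule top_gen_minimal)
  show "weak_opens \<L> \<subseteq> top_gen (opens X \<L>)"
  proof
    fix V assume "V \<in> weak_opens \<L>"
    then obtain \<U> where "\<U> \<subseteq> \<L>" "V = \<Union>\<U>" unfolding weak_opens_def by blast
    then have "\<U> \<subseteq> top_gen (opens X \<L>)"
      using subset_opens[OF assms] subset_top_gen[of "opens X \<L>"] by blast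
    then show "V \<in> top_gen (opens X \<L>)"
      unfolding \<open>V = \<Union>\<U>\<close> by (rule istopology_Union[OF istopology_top_gen])
  qed
qed

text \<open>
  The inclusion from left to right is minimality of the generated generalized topology. For the
  other one, a family \<open>\<W>\<close> that is essentially finite on small sets is assembled from generators:
  \<open>\<L>\<close> is an admissible covering, hence so is its trace on \<open>\<Union>\<W>\<close>, and on each piece \<open>A\<close> of this trace
  \<open>\<W>\<close> is essentially finite. Transitivity glues the families of all \<open>W \<inter> A\<close> and saturation coarsens
  the result to \<open>\<W>\<close>.
\<close>

lemma generated_gt_EF:
  assumes lss: "locally_small_space X \<L>"
  defines "\<S> \<equiv> small_weak_opens X \<L>"
  shows "generated_gt X (EF (opens X \<L>) \<L> \<union> EssFin X (weak_opens \<L>)) = EF (weak_opens \<L>) \<S>"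
    (is "?G = _")
proof
  note iff = small_weak_opens_iff[OF lss, folded \<S>_def]
  have gts: "generalized_topological_space X (weak_opens \<L>) (EF (weak_opens \<L>) \<S>)"
    using generalized_topological_space_EF[OF locally_small_space_small_weak_opens[OF lss]]
    by (simp add: opens_small_weak_opens[OF lss] \<S>_def)
  show "?G \<subseteq> EF (weak_opens \<L>) \<S>"
  proof (rule generated_gt_minimal[OF gts], rule Un_least; rule subsetI)
    fix \<W> assume \<W>: "\<W> \<in> EF (opens X \<L>) \<L>"
    have "essentially_finite_on \<W> B" if "B \<in> \<S>" for B
    proof -
      from that obtain L where "L \<in> \<L>" "B \<subseteq> L" unfolding iff by blast
      with \<W> show ?thesis by (auto simp: EF_iff intro: essentially_finite_on_mono)
    qed
    then show "\<W> \<in> EF (weak_opens \<L>) \<S>"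
      using \<W> opens_subset_weak_opens[OF lss] by (auto simp: EF_iff)
  next
    fix \<W> assume "\<W> \<in> EssFin X (weak_opens \<L>)"
    moreover have "B \<subseteq> X" if "B \<in> \<S>" for B using that weak_opens_subset[OF lss] by (simp add: iff)
    ultimately show "\<W> \<in> EF (weak_opens \<L>) \<S>"
      using essentially_finite_on_mono[of \<W> X] by (simp add: EF_iff EssFin_iff)
  qed
  show "EF (weak_opens \<L>) \<S> \<subseteq> ?G"
  proof
    fix \<W> assume \<W>: "\<W> \<in> EF (weak_opens \<L>) \<S>"
    then have \<W>_weak: "\<W> \<subseteq> weak_opens \<L>" by (simp add: EF_iff)
    have G: "generalized_topological_space X (weak_opens \<L>) ?G"
      using pt_gts_space[OF generalized_topological_space_EF[OF lss]]
      by (simp add: top_gen_opens[OF lss])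
    note D = generalized_topological_spaceD[OF G]
    have gen: "EF (opens X \<L>) \<L> \<union> EssFin X (weak_opens \<L>) \<subseteq> ?G" by (rule subset_generated_gt)
    let ?\<A> = "(\<lambda>L. \<Union>\<W> \<inter> L) ` \<L>"
    have Union_weak: "\<Union>\<W> \<in> weak_opens \<L>" using weak_opens_Union[OF \<W>_weak] .
    have \<A>: "?\<A> \<in> ?G"
      using gen smops_in_EF[OF lss] Union_weak by (intro D(6)) auto
    have pieces: "(\<lambda>W. W \<inter> A) ` \<W> \<in> ?G \<and> \<Union>((\<lambda>W. W \<inter> A) ` \<W>) = A" if "A \<in> ?\<A>" for A
    proof
      from that obtain L where L: "L \<in> \<L>" "A = \<Union>\<W> \<inter> L" by blast
      show "\<Union>((\<lambda>W. W \<inter> A) ` \<W>) = A" using L(2) by blast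
      have "L \<in> weak_opens \<L>" using L(1) subset_weak_opens by blast
      then have weak: "A \<in> weak_opens \<L>" using weak_opens_Int[OF lss Union_weak] L(2) by simp
      then have "A \<in> \<S>" using L unfolding iff by blast
      then have "essentially_finite_on \<W> A" using \<W> by (simp add: EF_iff)
      then have "essentially_finite_on ((\<lambda>W. W \<inter> A) ` \<W>) X"
        unfolding essentially_finite_on_iff
      proof (elim exE conjE)
        fix \<F> assume "\<F> \<subseteq> \<W>" "finite \<F>" "\<Union>\<W> \<inter> A \<subseteq> \<Union>\<F>"
        then show "\<exists>\<F>\<subseteq>(\<lambda>W. W \<inter> A) ` \<W>. finite \<F> \<and> \<Union>((\<lambda>W. W \<inter> A) ` \<W>) \<inter> X \<subseteq> \<Union>\<F>"
          by (intro exI[of _ "(\<lambda>W. W \<inter> A) ` \<F>"]) auto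
      qed
      then have "(\<lambda>W. W \<inter> A) ` \<W> \<in> EssFin X (weak_opens \<L>)"
        using weak_opens_Int[OF lss _ weak] \<W>_weak by (auto simp: EssFin_iff)
      then show "(\<lambda>W. W \<inter> A) ` \<W> \<in> ?G" using gen by blast
    qed
    have glued: "(\<Union>A\<in>?\<A>. (\<lambda>W. W \<inter> A) ` \<W>) \<in> ?G" by (rule D(7)[OF \<A> pieces])
    show "\<W> \<in> ?G"
    proof (rule D(8)[OF glued \<W>_weak])
      have "\<Union>\<W> \<subseteq> \<Union>\<L>"
        using weak_opens_subset[OF lss Union_weak] locally_small_spaceD(5)[OF lss] by simp
      then have cover: "\<exists>L\<in>\<L>. x \<in> L" if "x \<in> \<Union>\<W>" for x using that by blast
      show "\<Union>(\<Union>A\<in>?\<A>. (\<lambda>W. W \<inter> A) ` \<W>) = \<Union>\<W>"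
      proof (rule set_eqI, rule iffI)
        fix x assume "x \<in> \<Union>\<W>"
        with cover[of x] obtain L where L: "L \<in> \<L>" "x \<in> L" by blast
        from L(1) have A: "\<Union>\<W> \<inter> L \<in> ?\<A>" by (rule imageI)
        have "x \<in> \<Union>((\<lambda>W. W \<inter> (\<Union>\<W> \<inter> L)) ` \<W>)"
          using pieces[OF A] L(2) \<open>x \<in> \<Union>\<W>\<close> by (simp only:) blast
        then show "x \<in> \<Union>(\<Union>A\<in>?\<A>. (\<lambda>W. W \<inter> A) ` \<W>)"
          by (elim UnionE) (rule UnionI[OF UN_I[OF A]])
      next
        fix x assume "x \<in> \<Union>(\<Union>A\<in>?\<A>. (\<lambda>W. W \<inter> A) ` \<W>)"
        then obtain A T where "T \<in> (\<lambda>W. W \<inter> A) ` \<W>" "x \<in> T" by (elim UnionE UN_E)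
        then show "x \<in> \<Union>\<W>" by auto
      qed
    next
      fix T assume "T \<in> (\<Union>A\<in>?\<A>. (\<lambda>W. W \<inter> A) ` \<W>)"
      then obtain A W where "W \<in> \<W>" "T = W \<inter> A" by blast
      then show "\<exists>W\<in>\<W>. T \<subseteq> W" by blast
    qed
  qed
qed

lemma pt_gts_gts_of_lss:
  assumes "A \<in> Obj LSS"
  shows "pt_gts (gts_of_lss A) = gts_of_lss (pt_lss A)"
proof -
  obtain X \<L> where A: "A = (X, \<L>)" by (cases A)
  with assms have lss: "locally_small_space X \<L>" by (simp add: Obj_LSS)
  show ?thesis
    using pt_gts_eq[OF generalized_topological_space_EF[OF lss]]
    by (simp add: A gts_of_lss_def pt_lss_def top_gen_opens[OF lss] generated_gt_EF[OF lss]
        opens_small_weak_opens[OF lss])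
qed

theorem theorem2p71:
  shows
    "concrete_coreflector (LSS :: ('a lss, 'a) concrete_cat) LSS_pt pt_lss \<and>
     full_concrete_embedding (LSS :: ('a lss, 'a) concrete_cat) GTS gts_of_lss \<and>
     full_concrete_embedding (LSS_pt :: ('a lss, 'a) concrete_cat) GTS_pt gts_of_lss \<and>
     concrete_functor (GTS :: ('a gts, 'a) concrete_cat) GTS_pt pt_gts \<and>
     (\<forall>A \<in> Obj (LSS :: ('a lss, 'a) concrete_cat). pt_gts (gts_of_lss A) = gts_of_lss (pt_lss A))"
  using concrete_coreflector_pt_lss full_concrete_embedding_LSS full_concrete_embedding_LSS_pt
    concrete_functor_pt_gts pt_gts_gts_of_lss by blast

end
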